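(* Suppose $k\in C^{1,0}(\bar Q_T)$, $q,f\in C(\bar Q_T)$, $k(x,t)\ge c_1>0$ and $q(x,t)\ge 0$ everywhere on $\bar Q_T$, and $\beta_i,\mu_i\in C[0,T]$ with $\beta_i(t)\ge\beta_0>0$ for all $t\in[0,T]$, $i=1,2$. Let $u\in C^{2,1}(\bar Q_T)$ be a solution of the Robin problem $$\mathbb{P}^{(\theta)}_{(\omega)}(\partial_{0t})u(x,t)=\frac{\partial}{\partial x}\Big(k(x,t)\frac{\partial u}{\partial x}\Big)-q(x,t)u+f(x,t),\quad 0<x<l,\ 0<t\le T,$$ $$k(0,t)u_x(0,t)=\beta_1(t)u(0,t)-\mu_1(t),\qquad -k(l,t)u_x(l,t)=\beta_2(t)u(l,t)-\mu_2(t),\quad 0\le t\le T,$$ $$u(x,0)=u_0(x),\quad 0\le x\le l.$$ Then for all $t\in(0,T]$ the following a priori estimate holds: $$\int_0^l \mathbb{P}^{(\theta-1)}_{(\omega)}(D_{0t})u^2(x,t)\,dx+\gamma_1\int_0^t\big(\|u_x(x,s)\|_0^2+u^2(0,s)+u^2(l,s)\big)ds$$ $$\le \frac{\delta_1}{\gamma_1}\int_0^t\big(\|f(x,s)\|_0^2+\mu_1^2(s)+\mu_2^2(s)\big)ds+\int_0^l u_0^2(x)\Big(\int_\alpha^\beta\sum_{r=1}^m\frac{\omega_r(x,\gamma)\,t^{1-\theta_r(x,\gamma)}}{\Gamma(2-\theta_r(x,\gamma))}\,d\gamma\Big)dx,$$ where $\gamma_1=\min\{c_1,\beta_0\}$ and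 $\delta_1=\max\{1+l,l^2\}$.
   Context: Let $l,T>0$, $\alpha<\beta$ real, $m\ge 1$ an integer, and $\bar Q_T=\{(x,t):0\le x\le l,\ 0\le t\le T\}$. $C^{m,n}(\bar Q_T)$ is the class of functions continuous on $\bar Q_T$ together with their partial derivatives of order up to $m$ in $x$ and up to $n$ in $t$. Standing assumptions: for $r=1,\dots,m$, $\theta_r$ is continuous on $[0,l]\times[\alpha,\beta]$ with $0<\theta_r(x,\gamma)<1$; $\omega_r(x,\gamma)\ge 0$ on $[0,l]\times[\alpha,\beta]$, with $\omega_r$ Lebesgue integrable on $[0,l]\times[\alpha,\beta]$ and $\omega_r(x,\cdot)$ integrable on $[\alpha,\beta]$ for each $x$; $\int_\alpha^\beta\sum_{r=1}^m\omega_r(x,\gamma)\,d\gamma>0$ for all $x\in[0,l]$; and $k(x,t)\le c_2$ on $\bar Q_T$ for some constant $c_2$. For $0<\theta<1$ the Caputo derivative of order $\theta$ is $\partial_{0t}^{\theta}u(x,t)=\frac{1}{\Gamma(1-\theta)}\int_0^t\frac{u_\eta(x,\eta)}{(t-\eta)^{\theta}}\,d\eta$, and for $\nu>0$ the Riemann–Liouville integral of order $\nu$ is $D_{0t}^{-\nu}u(x,t)=\frac1{\Gamma(\nu)}\int_0^t(t-s)^{\nu-1}u(x,s)\,ds$. Define $$\mathbb{P}^{(\theta)}_{(\omega)}(\partial_{0t})u(x,t)=\int_\alpha^\beta\sum_{r=1}^m\omega_r(x,\gamma)\,\partial_{0t}^{\theta_r(x,\gamma)}u(x,t)\,d\gamma,$$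 $$\mathbb{P}^{(\theta-1)}_{(\omega)}(D_{0t})u(x,t)=\int_\alpha^\beta\sum_{r=1}^m\omega_r(x,\gamma)\,D_{0t}^{\theta_r(x,\gamma)-1}u(x,t)\,d\gamma .$$ In $\mathbb{P}^{(\theta-1)}_{(\omega)}(D_{0t})u^2(x,t)$ the operator is applied to the function $u^2$. The norm is $\|u\|_0^2=\|u(x,t)\|_0^2=\int_0^l u^2(x,t)\,dx$ (integration over $x$ at fixed time). *)

theory Defs
  imports "HOL-Analysis.Analysis"
begin

text \<open>
  Functions of \<open>(x,t)\<close> are curried. Partial derivatives on the closed rectangle are taken within
  \<open>[0,l]\<close> resp. \<open>[0,T]\<close>, hence they are one-sided on its boundary.
\<close>

abbreviation rect :: "real \<Rightarrow> real \<Rightarrow> (real \<times> real) set" where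
  "rect l T \<equiv> {0..l} \<times> {0..T}"

definition Dx :: "real \<Rightarrow> (real \<Rightarrow> real \<Rightarrow> real) \<Rightarrow> real \<Rightarrow> real \<Rightarrow> real" where
  "Dx l u x t = vector_derivative (\<lambda>y. u y t) (at x within {0..l})"

definition Dt :: "real \<Rightarrow> (real \<Rightarrow> real \<Rightarrow> real) \<Rightarrow> real \<Rightarrow> real \<Rightarrow> real" where
  "Dt T u x t = vector_derivative (\<lambda>s. u x s) (at t within {0..T})"

text \<open>
  The class \<open>C\<^sup>m\<^sup>,\<^sup>n\<close> constrains the pure derivatives in \<open>x\<close> up to order \<open>m\<close> and in \<open>t\<close> up to
  order \<open>n\<close>; nothing is required of mixed derivatives. Since \<open>vector_derivative\<close> is total,
  differentiability is demanded explicitly.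
\<close>

definition C_class :: "real \<Rightarrow> real \<Rightarrow> nat \<Rightarrow> nat \<Rightarrow> (real \<Rightarrow> real \<Rightarrow> real) \<Rightarrow> bool" where
  "C_class l T m n u \<longleftrightarrow>
     (\<forall>i<m. \<forall>x\<in>{0..l}. \<forall>t\<in>{0..T}.
        (\<lambda>y. (Dx l ^^ i) u y t) differentiable (at x within {0..l})) \<and>
     (\<forall>j<n. \<forall>x\<in>{0..l}. \<forall>t\<in>{0..T}.
        (\<lambda>s. (Dt T ^^ j) u x s) differentiable (at t within {0..T})) \<and>
     (\<forall>i\<le>m. continuous_on (rect l T) (\<lambda>(x, t). (Dx l ^^ i) u x t)) \<and>
     (\<forall>j\<le>n. continuous_on (rect l T) (\<lambda>(x, t). (Dt T ^^ j) u x t))"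

text \<open>
  In the next two definitions the integrands take conventional values at the endpoints
  (\<open>0 powr a = 0\<close>, \<open>a / 0 = 0\<close>, and \<open>deriv g 0\<close> may depend on values of \<open>g\<close> at negative arguments);
  this affects a null set only.
\<close>

definition caputo :: "real \<Rightarrow> (real \<Rightarrow> real) \<Rightarrow> real \<Rightarrow> real" where
  "caputo \<theta> g t =
     1 / Gamma (1 - \<theta>) * (LINT \<eta>:{0..t}|lebesgue. deriv g \<eta> / (t - \<eta>) powr \<theta>)"

definition rl_integral :: "real \<Rightarrow> (real \<Rightarrow> real) \<Rightarrow> real \<Rightarrow> real" where
  "rl_integral \<nu> g t =
     1 / Gamma \<nu> * (LINT s:{0..t}|lebesgue. (t - s) powr (\<nu> - 1) * g s)"

definition P_caputo ::
  "real \<Rightarrow> real \<Rightarrow> nat \<Rightarrow> (nat \<Rightarrow> real \<Rightarrow> real \<Rightarrow> real) \<Rightarrow> (nat \<Rightarrow> real \<Rightarrow> real \<Rightarrow> real) \<Rightarrow>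
   (real \<Rightarrow> real \<Rightarrow> real) \<Rightarrow> real \<Rightarrow> real \<Rightarrow> real" where
  "P_caputo \<alpha> \<beta> m \<theta> \<omega> u x t =
     (LINT \<gamma>:{\<alpha>..\<beta>}|lebesgue. \<Sum>r=1..m. \<omega> r x \<gamma> * caputo (\<theta> r x \<gamma>) (\<lambda>s. u x s) t)"

text \<open>The Riemann--Liouville operator of order \<open>\<theta> - 1 < 0\<close> is the integral of order \<open>1 - \<theta>\<close>.\<close>

definition P_rl ::
  "real \<Rightarrow> real \<Rightarrow> nat \<Rightarrow> (nat \<Rightarrow> real \<Rightarrow> real \<Rightarrow> real) \<Rightarrow> (nat \<Rightarrow> real \<Rightarrow> real \<Rightarrow> real) \<Rightarrow>
   (real \<Rightarrow> real \<Rightarrow> real) \<Rightarrow> real \<Rightarrow> real \<Rightarrow> real" where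
  "P_rl \<alpha> \<beta> m \<theta> \<omega> u x t =
     (LINT \<gamma>:{\<alpha>..\<beta>}|lebesgue. \<Sum>r=1..m. \<omega> r x \<gamma> * rl_integral (1 - \<theta> r x \<gamma>) (\<lambda>s. u x s) t)"

definition norm0_sq :: "real \<Rightarrow> (real \<Rightarrow> real \<Rightarrow> real) \<Rightarrow> real \<Rightarrow> real" where
  "norm0_sq l u t = (LINT x:{0..l}|lebesgue. (u x t)\<^sup>2)"

end

theory Submission
  imports Defs
begin

text \<open>
  Multiply the equation by \<open>2 u\<close> and integrate over the rectangle. In time, the convexity inequality
  \<open>2 v \<partial>\<^sup>\<theta> v \<ge> \<partial>\<^sup>\<theta> (v\<^sup>2)\<close> and \<open>\<integral> \<partial>\<^sup>\<theta> w ds = D\<^sup>\<theta>\<^sup>-\<^sup>1 w (t) - w (0) t\<^sup>1\<^sup>-\<^sup>\<theta> / \<Gamma>(2 - \<theta>)\<close> with \<open>w = v\<^sup>2\<close> produce,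
  for each fixed \<open>x\<close>, the fractional energy and the initial term. In space, integration by parts with
  the Robin conditions, Young's inequality with weight \<open>\<delta>\<^sub>1 / \<gamma>\<^sub>1\<close> and
  \<open>\<parallel>u\<parallel>\<^sup>2 \<le> l\<^sup>2 \<parallel>u\<^sub>x\<parallel>\<^sup>2 + l (u(0)\<^sup>2 + u(l)\<^sup>2)\<close> bound the source terms.
  All exchanges of integrals are legitimate because \<open>\<theta>\<close> ranges, on a compact set, in \<open>(0,1)\<close>: the
  fractional integrals are then jointly continuous, and \<open>\<omega>\<close> only enters as an integrable weight.
\<close>

section \<open>Weighted Fubini theorems for Lebesgue integrals\<close>

lemma set_lebesgue_integral_continuous:
  fixes f :: "real \<Rightarrow> real"
  assumes "continuous_on {a..b} f"
  shows "(LINT x:{a..b}|lebesgue. f x) = integral {a..b} f"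
  using set_lebesgue_integral_eq_integral(2)[OF absolutely_integrable_continuous_real[OF assms]] .

lemma absolutely_integrable_continuous_mult:
  fixes f g :: "real \<Rightarrow> real"
  assumes "continuous_on {a..b} f" and "g absolutely_integrable_on {a..b}"
  shows "(\<lambda>x. g x * f x) absolutely_integrable_on {a..b}"
proof -
  have "(\<lambda>x. f x * g x) absolutely_integrable_on {a..b}"
    by (rule absolutely_integrable_bounded_measurable_product_real)
      (use assms in \<open>auto intro!: continuous_imp_measurable_on_sets_lebesgue
         compact_imp_bounded compact_continuous_image\<close>)
  then show ?thesis by (simp add: mult.commute)
qed

lemma powr_absolutely_integrable:
  fixes a c :: real
  assumes "a > -1" "0 \<le> c"
  shows "(\<lambda>x. x powr a) absolutely_integrable_on {0..c}"
    and "(LINT x:{0..c}|lebesgue. x powr a) = c powr (a + 1) / (a + 1)"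
proof -
  show *: "(\<lambda>x. x powr a) absolutely_integrable_on {0..c}"
    by (rule nonnegative_absolutely_integrable_1[OF integrable_on_powr_from_0[OF assms]]) auto
  show "(LINT x:{0..c}|lebesgue. x powr a) = c powr (a + 1) / (a + 1)"
    using set_lebesgue_integral_eq_integral(2)[OF *] has_integral_powr_from_0[OF assms]
    by (simp add: integral_unique)
qed

text \<open>Measurability of \<open>f\<close> is derived from completeness of Lebesgue measure: the
  exceptional set is negligible, and absolute integrability survives a change there. In this way
  Fubini results for a Borel version are carried back to a function that is only Lebesgue
  measurable.\<close>

lemma integral_AE_eq_lebesgue:
  fixes f g :: "'a::euclidean_space \<Rightarrow> real"
  assumes g: "integrable lebesgue g" and ae: "AE x in lebesgue. f x = g x"
  shows "integrable lebesgue f" and "integral\<^sup>L lebesgue f = integral\<^sup>L lebesgue g"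
proof -
  obtain N where N: "N \<in> null_sets lebesgue" "{x \<in> space lebesgue. f x \<noteq> g x} \<subseteq> N"
    using ae unfolding eventually_ae_filter by auto
  have "f absolutely_integrable_on UNIV"
    by (rule absolutely_integrable_spike[where f=g and S=N])
      (use g N in \<open>auto simp: negligible_iff_null_sets set_integrable_def\<close>)
  then show f: "integrable lebesgue f" by (simp add: set_integrable_def)
  show "integral\<^sup>L lebesgue f = integral\<^sup>L lebesgue g"
    by (intro integral_cong_AE borel_measurable_integrable f g ae)
qed

text \<open>Several identities below are known only off the ends of an interval: the value of
  \<open>deriv\<close> at 0 and \<open>t\<close>, the equation at time 0, the equation at
  \<open>x = 0\<close> and \<open>x = l\<close>. A finite exceptional set is invisible to
  integrability and to the integral.\<close>

lemma absolutely_integrable_spike_finite: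
  fixes f g :: "real \<Rightarrow> real"
  assumes "g absolutely_integrable_on S" "finite F" "\<And>x. x \<in> S - F \<Longrightarrow> f x = g x"
  shows "f absolutely_integrable_on S"
    and "(LINT x:S|lebesgue. f x) = (LINT x:S|lebesgue. g x)"
proof -
  show f: "f absolutely_integrable_on S"
    by (rule absolutely_integrable_spike[OF assms(1) _ assms(3)]) (use assms in auto)
  have "integral S f = integral S g"
    by (rule integral_spike[where S=F]) (use assms in auto)
  then show "(LINT x:S|lebesgue. f x) = (LINT x:S|lebesgue. g x)"
    by (simp add: set_lebesgue_integral_eq_integral(2)[OF f] set_lebesgue_integral_eq_integral(2)[OF assms(1)])
qed

section \<open>Fubini with a weight that is only integrable\<close>

lemma sigma_finite_lebesgue: "sigma_finite_measure (lebesgue :: real measure)"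
proof
  obtain A :: "real set set" where A: "countable A" "A \<subseteq> sets lborel" "\<Union>A = space lborel"
      "\<forall>a\<in>A. emeasure lborel a \<noteq> \<infinity>"
    using lborel.sigma_finite_countable by blast
  then show "\<exists>A :: real set set. countable A \<and> A \<subseteq> sets lebesgue \<and> \<Union>A = space lebesgue \<and>
      (\<forall>a\<in>A. emeasure lebesgue a \<noteq> \<infinity>)"
    by (intro exI[of _ A]) (auto simp: subset_iff)
qed

text \<open>Since the weight depends on \<open>y\<close> alone, \<open>w y * C x y\<close> is
  measurable for the product of two Lebesgue sigma-algebras, and \<open>|M| * |w y|\<close>
  dominates it. \<open>C\<close> is asked to be bounded and Borel, which covers a function cut off
  along the diagonal of a square; the weight is the kernel \<open>\<tau> powr (\<nu> - 1)\<close> in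
  one use and \<open>\<omega>\<close> in the other.\<close>

lemma set_integral_weighted_swap:
  fixes w :: "real \<Rightarrow> real" and C :: "real \<Rightarrow> real \<Rightarrow> real"
  assumes w: "w absolutely_integrable_on {c..d}"
    and C: "(\<lambda>(x, y). indicator ({a..b} \<times> {c..d}) (x, y) * C x y) \<in> borel_measurable borel"
    and M: "\<And>x y. x \<in> {a..b} \<Longrightarrow> y \<in> {c..d} \<Longrightarrow> \<bar>C x y\<bar> \<le> M"
  shows "(\<lambda>x. LINT y:{c..d}|lebesgue. w y * C x y) absolutely_integrable_on {a..b}"
    and "(LINT x:{a..b}|lebesgue. LINT y:{c..d}|lebesgue. w y * C x y)
       = (LINT y:{c..d}|lebesgue. w y * (LINT x:{a..b}|lebesgue. C x y))"
proof -
  interpret L: sigma_finite_measure "lebesgue :: real measure"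
    by (rule sigma_finite_lebesgue)
  interpret P: pair_sigma_finite "lebesgue :: real measure" "lebesgue :: real measure" ..
  define W where "W y = indicator {c..d} y * w y" for y
  define D where "D = (\<lambda>(x, y). indicator ({a..b} \<times> {c..d}) (x, y) * C x y)"
  define F where "F = (\<lambda>p. W (snd p) * D p)"
  have W: "integrable lebesgue W"
    using w unfolding W_def[abs_def] set_integrable_def real_scaleR_def .
  have Wm[measurable]: "W \<in> borel_measurable lebesgue"
    using W by (rule borel_measurable_integrable)
  \<comment> \<open>The identity is measurable from this product to the Borel plane, so Borel
    functions of two variables are admissible.\<close>
  have id: "(\<lambda>p. (fst p, snd p)) \<in> borel_measurable (lebesgue \<Otimes>\<^sub>M lebesgue :: (real \<times> real) measure)"
    by (intro borel_measurable_Pair measurable_compose[OF measurable_fst] measurable_compose[OF measurable_snd]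
        measurable_completion) auto
  have Dm[measurable]: "D \<in> borel_measurable (lebesgue \<Otimes>\<^sub>M lebesgue)"
    using measurable_compose[OF id, of D borel] C by (simp add: D_def)
  have Fm: "F \<in> borel_measurable (lebesgue \<Otimes>\<^sub>M lebesgue)"
    unfolding F_def by measurable
  have "0 \<le> M" if "x \<in> {a..b}" "y \<in> {c..d}" for x y
    using M[OF that] by linarith
  \<comment> \<open>If the rectangle is empty, \<open>M\<close> may be negative; hence the bound
    with \<open>|M|\<close>.\<close>
  then have Db: "\<bar>D (x, y)\<bar> \<le> indicator {a..b} x * \<bar>M\<bar>" for x y
    using M by (fastforce simp: D_def indicator_def)
  have F_eq: "F (x, y) = indicator {a..b} x * (indicator {c..d} y * (w y * C x y))" for x y
    by (simp add: F_def D_def W_def indicator_def)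
  have Fb: "norm (F (x, y)) \<le> indicator {a..b} x * (\<bar>M\<bar> * norm (W y))" for x y
    using mult_left_mono[OF Db[of x y] abs_ge_zero[of "W y"]] by (simp add: F_def abs_mult algebra_simps)
  have int: "integrable lebesgue (\<lambda>y. F (x, y))" for x
  proof (rule Bochner_Integration.integrable_bound)
    show "integrable lebesgue (\<lambda>y. indicator {a..b} x * (\<bar>M\<bar> * norm (W y)))"
      using W by simp
    show "(\<lambda>y. F (x, y)) \<in> borel_measurable lebesgue"
      using Fm by (rule measurable_compose_Pair1[rotated]) simp
    show "AE y in lebesgue. norm (F (x, y)) \<le> norm (indicator {a..b} x * (\<bar>M\<bar> * norm (W y)))"
      using Fb by (auto intro!: AE_I2 order_trans[OF Fb])
  qed
  have Fint: "integrable (lebesgue \<Otimes>\<^sub>M lebesgue) F"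
  proof (rule P.Fubini_integrable[OF Fm])
    show "integrable lebesgue (\<lambda>x. \<integral>y. norm (F (x, y)) \<partial>lebesgue)"
    proof (rule Bochner_Integration.integrable_bound)
      show "integrable lebesgue (\<lambda>x. indicator {a..b} x * (\<bar>M\<bar> * (\<integral>y. norm (W y) \<partial>lebesgue)))"
        using absolutely_integrable_continuous_real[of a b "\<lambda>_. 1 :: real"]
        by (simp add: set_integrable_def)
      show "(\<lambda>x. \<integral>y. norm (F (x, y)) \<partial>lebesgue) \<in> borel_measurable lebesgue"
        using Fm by (intro L.borel_measurable_lebesgue_integral) (simp add: case_prod_beta)
      have "(\<integral>y. norm (F (x, y)) \<partial>lebesgue) \<le> (\<integral>y. indicator {a..b} x * (\<bar>M\<bar> * norm (W y)) \<partial>lebesgue)" for x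
        using W int by (intro integral_mono Fb) auto
      then show "AE x in lebesgue. norm (\<integral>y. norm (F (x, y)) \<partial>lebesgue)
          \<le> norm (indicator {a..b} x * (\<bar>M\<bar> * (\<integral>y. norm (W y) \<partial>lebesgue)))"
        by (auto intro!: AE_I2 simp: abs_mult)
    qed
  qed (use int in auto)
  then have Fint': "integrable (lebesgue \<Otimes>\<^sub>M lebesgue) (case_prod (\<lambda>x y. F (x, y)))"
    by (simp add: case_prod_beta)
  have e1: "(\<integral>y. F (x, y) \<partial>lebesgue) = indicator {a..b} x * (LINT y:{c..d}|lebesgue. w y * C x y)" for x
    by (simp add: F_eq set_lebesgue_integral_def)
  have e2: "(\<integral>x. F (x, y) \<partial>lebesgue) = indicator {c..d} y * (w y * (LINT x:{a..b}|lebesgue. C x y))" for y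
  proof -
    have "F (x, y) = (indicator {c..d} y * w y) * (indicator {a..b} x * C x y)" for x
      by (simp add: F_eq)
    then show ?thesis by (simp add: set_lebesgue_integral_def)
  qed
  show "(\<lambda>x. LINT y:{c..d}|lebesgue. w y * C x y) absolutely_integrable_on {a..b}"
    using P.integrable_fst[OF Fint'] by (simp add: e1 set_integrable_def)
  show "(LINT x:{a..b}|lebesgue. LINT y:{c..d}|lebesgue. w y * C x y)
       = (LINT y:{c..d}|lebesgue. w y * (LINT x:{a..b}|lebesgue. C x y))"
    using P.integral_fst[OF Fint'] P.integral_snd[OF Fint']
    by (simp add: e1 e2 set_lebesgue_integral_def)
qed

lemma bounded_continuous_rect:
  fixes C :: "real \<Rightarrow> real \<Rightarrow> real"
  assumes "continuous_on ({a..b} \<times> {c..d}) (\<lambda>(x, y). C x y)"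
  obtains M where "\<And>x y. x \<in> {a..b} \<Longrightarrow> y \<in> {c..d} \<Longrightarrow> \<bar>C x y\<bar> \<le> M"
proof -
  have "bounded ((\<lambda>(x, y). C x y) ` ({a..b} \<times> {c..d}))"
    by (intro compact_imp_bounded compact_continuous_image assms compact_Times) auto
  then show ?thesis using that unfolding bounded_iff by fastforce
qed

text \<open>Here the weight is integrable for Lebesgue measure on the plane, whose sigma-algebra is
  larger than the product of the one-dimensional ones. The product of weight and \<open>C\<close> is
  therefore replaced by a Borel function \<open>G\<close> equal to it almost everywhere. Fubini for
  \<open>lborel\<close> applies to \<open>G\<close>, and for almost every \<open>x\<close> the two
  slices agree almost everywhere.\<close>

lemma set_integral_weighted_slice:
  fixes w C :: "real \<Rightarrow> real \<Rightarrow> real"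
  assumes w: "set_integrable lebesgue ({a..b} \<times> {c..d}) (\<lambda>(x, y). w x y)"
    and C: "continuous_on ({a..b} \<times> {c..d}) (\<lambda>(x, y). C x y)"
  shows "(\<lambda>x. LINT y:{c..d}|lebesgue. w x y * C x y) absolutely_integrable_on {a..b}"
proof -
  let ?R = "{a..b} \<times> {c..d}"
  obtain M where M: "\<And>x y. x \<in> {a..b} \<Longrightarrow> y \<in> {c..d} \<Longrightarrow> \<bar>C x y\<bar> \<le> M"
    using bounded_continuous_rect[OF C] by blast
  define F where "F = (\<lambda>(x, y). indicator ?R (x, y) * (w x y * C x y))"
  have R: "?R \<in> sets borel" by (intro borel_closed closed_Times) auto
  have "(\<lambda>p. indicator ?R p *\<^sub>R (\<lambda>(x, y). C x y) p) \<in> borel_measurable borel"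
    by (rule borel_measurable_continuous_on_indicator[OF R C])
  then have Cm: "(\<lambda>p. indicator ?R p *\<^sub>R (\<lambda>(x, y). C x y) p) \<in> borel_measurable lebesgue"
    by (intro measurable_completion) simp
  have wi: "integrable lebesgue (\<lambda>p. indicator ?R p *\<^sub>R (\<lambda>(x, y). w x y) p)"
    using w by (simp add: set_integrable_def)
  have Fi: "integrable lebesgue F"
  proof (rule Bochner_Integration.integrable_bound)
    show "integrable lebesgue (\<lambda>p. M * norm (indicator ?R p *\<^sub>R (\<lambda>(x, y). w x y) p))"
      using wi by (intro integrable_mult_right integrable_norm)
    have "F = (\<lambda>p. (indicator ?R p *\<^sub>R (\<lambda>(x, y). w x y) p) * (indicator ?R p *\<^sub>R (\<lambda>(x, y). C x y) p))"
      by (auto simp: F_def indicator_def)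
    then show "F \<in> borel_measurable lebesgue"
      using borel_measurable_times[OF borel_measurable_integrable[OF wi] Cm] by simp
    have "norm (F p) \<le> norm (M * norm (indicator ?R p *\<^sub>R (\<lambda>(x, y). w x y) p))" for p
    proof (cases "p \<in> ?R")
      case True
      then obtain x y where p: "p = (x, y)" "x \<in> {a..b}" "y \<in> {c..d}" by auto
      then have "\<bar>w x y\<bar> * \<bar>C x y\<bar> \<le> \<bar>w x y\<bar> * \<bar>M\<bar>"
        using M[of x y] by (intro mult_left_mono) auto
      then show ?thesis using p by (simp add: F_def abs_mult mult.commute)
    qed (auto simp: F_def indicator_def split: prod.splits)
    then show "AE p in lebesgue. norm (F p) \<le> norm (M * norm (indicator ?R p *\<^sub>R (\<lambda>(x, y). w x y) p))"
      by auto
  qed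
  obtain G where G: "G \<in> borel_measurable lborel" "AE p in lborel. F p = G p"
    using completion_ex_borel_measurable_real[OF borel_measurable_integrable[OF Fi]] by blast
  have "integrable lebesgue G"
    by (rule integral_AE_eq_lebesgue(1)[OF Fi], rule AE_completion)
      (use G(2) in eventually_elim, simp)
  then have "integrable lborel G"
    using integrable_completion[of G lborel] G(1) by simp
  then have Gi: "integrable (lborel \<Otimes>\<^sub>M lborel) G" by (simp add: lborel_prod)
  have "AE p in lborel \<Otimes>\<^sub>M lborel. F p = G p"
    using G(2) by (subst lborel_prod)
  then have "AE x in lborel. AE y in lborel. F (x, y) = G (x, y)"
    by (rule lborel_pair.AE_pair[of "\<lambda>p. F p = G p"])
  then have "AE x in lborel. (\<integral>y. F (x, y) \<partial>lebesgue) = (\<integral>y. G (x, y) \<partial>lborel)"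
    using lborel_pair.AE_integrable_fst'[OF Gi]
  proof eventually_elim
    case (elim x)
    have "integrable lebesgue (\<lambda>y. G (x, y))"
      using integrable_completion[OF borel_measurable_integrable[OF elim(2)]] elim(2) by (rule iffD2)
    then have "(\<integral>y. F (x, y) \<partial>lebesgue) = (\<integral>y. G (x, y) \<partial>lebesgue)"
      by (rule integral_AE_eq_lebesgue(2)) (rule AE_completion[OF elim(1)])
    also have "\<dots> = (\<integral>y. G (x, y) \<partial>lborel)"
      by (rule integral_completion) (rule borel_measurable_integrable[OF elim(2)])
    finally show ?case .
  qed
  note ae = AE_completion[OF this]
  have "integrable lebesgue (\<lambda>x. \<integral>y. G (x, y) \<partial>lborel)"
    using integrable_completion[OF borel_measurable_integrable[OF lborel_pair.integrable_fst'[OF Gi]]]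
      lborel_pair.integrable_fst'[OF Gi] by (rule iffD2)
  then have "integrable lebesgue (\<lambda>x. \<integral>y. F (x, y) \<partial>lebesgue)"
    by (rule integral_AE_eq_lebesgue(1)[OF _ ae])
  moreover have "(\<integral>y. F (x, y) \<partial>lebesgue) = indicator {a..b} x * (LINT y:{c..d}|lebesgue. w x y * C x y)" for x
    by (simp add: F_def indicator_times mult.assoc set_lebesgue_integral_def)
  ultimately show ?thesis by (simp add: set_integrable_def)
qed

section \<open>Riemann--Liouville integrals and Caputo derivatives\<close>

text \<open>The substitution of \<open>t - s\<close> for \<open>s\<close> moves the singularity to
  0, where it no longer depends on \<open>t\<close>.\<close>

lemma rl_integral_reflect:
  "rl_integral \<nu> g t = 1 / Gamma \<nu> * (LINT s:{0..t}|lebesgue. s powr (\<nu> - 1) * g (t - s))"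
proof -
  have "(LINT s:{0..t}|lebesgue. (t - s) powr (\<nu> - 1) * g s)
      = (\<integral>s. indicator {0..t} (t + (-1) * s) *\<^sub>R ((t - (t + (-1) * s)) powr (\<nu> - 1) * g (t + (-1) * s)) \<partial>lebesgue)"
    unfolding set_lebesgue_integral_def
    by (subst lebesgue_integral_real_affine[where c="-1" and t=t]) auto
  also have "\<dots> = (LINT s:{0..t}|lebesgue. s powr (\<nu> - 1) * g (t - s))"
    unfolding set_lebesgue_integral_def
    by (rule Bochner_Integration.integral_cong) (auto simp: indicator_def)
  finally show ?thesis by (simp add: rl_integral_def)
qed

text \<open>A further scaling by \<open>t\<close> fixes the domain and leaves \<open>t\<close> only
  in a power and in the argument of \<open>g\<close>, the form in which continuity in order and time
  can be read off. At \<open>t = 0\<close> both sides vanish, since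
  \<open>0 powr \<nu> = 0\<close>.\<close>

lemma rl_integral_unit:
  assumes "0 \<le> t"
  shows "rl_integral \<nu> g t
    = t powr \<nu> / Gamma \<nu> * (LINT s:{0..1}|lebesgue. s powr (\<nu> - 1) * g (t * (1 - s)))"
proof (cases "t = 0")
  case True
  have "(LINT s:{0..0::real}|lebesgue. (0 - s) powr (\<nu> - 1) * g s) = 0"
    unfolding set_lebesgue_integral_def
    by (rule integral_eq_zero_AE) (rule AE_I[where N="{0}"], auto simp: indicator_def)
  then show ?thesis using True by (simp add: rl_integral_def)
next
  case False
  with assms have t: "t > 0" by simp
  have "(LINT s:{0..t}|lebesgue. s powr (\<nu> - 1) * g (t - s))
      = t * (\<integral>s. indicator {0..t} (0 + t * s) *\<^sub>R ((0 + t * s) powr (\<nu> - 1) * g (t - (0 + t * s))) \<partial>lebesgue)"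
    unfolding set_lebesgue_integral_def
    by (subst lebesgue_integral_real_affine[where c=t and t=0]) (use t in auto)
  also have "(\<integral>s. indicator {0..t} (0 + t * s) *\<^sub>R ((0 + t * s) powr (\<nu> - 1) * g (t - (0 + t * s))) \<partial>lebesgue)
      = (LINT s:{0..1}|lebesgue. t powr (\<nu> - 1) * (s powr (\<nu> - 1) * g (t * (1 - s))))"
    unfolding set_lebesgue_integral_def
    by (rule Bochner_Integration.integral_cong)
      (use t in \<open>auto simp: indicator_def powr_mult right_diff_distrib zero_le_mult_iff\<close>)
  also have "t * \<dots> = t powr \<nu> * (LINT s:{0..1}|lebesgue. s powr (\<nu> - 1) * g (t * (1 - s)))"
  proof -
    have "t * t powr (\<nu> - 1) = t powr \<nu>" using t by (simp add: powr_diff)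
    then show ?thesis
      by (subst set_integral_mult_right, subst mult.assoc[symmetric]) simp
  qed
  finally show ?thesis by (simp add: rl_integral_reflect)
qed

lemma rl_kernel_integrable:
  fixes g :: "real \<Rightarrow> real"
  assumes "0 < \<nu>" "continuous_on {0..t} g"
  shows "(\<lambda>s. (t - s) powr (\<nu> - 1) * g s) absolutely_integrable_on {0..t}"
proof (cases "0 \<le> t")
  case True
  have "(\<lambda>s. s powr (\<nu> - 1)) absolutely_integrable_on {0..t}"
    using powr_absolutely_integrable(1)[of "\<nu> - 1" t] assms(1) True by simp
  then have "(\<lambda>s. (t - s) powr (\<nu> - 1)) absolutely_integrable_on {0..t}"
    using lebesgue_integrable_real_affine[where c="-1" and t=t and f="\<lambda>s. indicator {0..t} s *\<^sub>R s powr (\<nu> - 1)"]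
    by (simp add: set_integrable_def indicator_def conj_commute)
  then show ?thesis by (rule absolutely_integrable_continuous_mult[OF assms(2)])
qed simp

text \<open>\<open>deriv\<close> is a two-sided derivative, so at 0 and \<open>t\<close> it may
  depend on values of \<open>v\<close> outside the interval. The identity is asked only in the
  interior, and the two ends are discarded as a null set.\<close>

lemma caputo_eq_rl_integral:
  assumes "\<theta> < 1" "continuous_on {0..t} g" "\<And>s. s \<in> {0<..<t} \<Longrightarrow> deriv v s = g s"
  shows "caputo \<theta> v t = rl_integral (1 - \<theta>) g t"
proof -
  have "(LINT s:{0..t}|lebesgue. deriv v s / (t - s) powr \<theta>)
      = (LINT s:{0..t}|lebesgue. (t - s) powr (1 - \<theta> - 1) * g s)"
    by (rule absolutely_integrable_spike_finite(2)[where F="{0, t}"])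
      (use rl_kernel_integrable[of "1 - \<theta>" t g] assms in \<open>auto simp: powr_minus divide_inverse\<close>)
  then show ?thesis by (simp add: caputo_def rl_integral_def)
qed

text \<open>Dominated convergence. On the unit interval \<open>s powr (\<nu> - 1)\<close> does not
  increase when \<open>\<nu>\<close> grows, so the smallest order, attained on the compact set
  \<open>S\<close> at \<open>p0\<close>, yields one integrable majorant for all
  \<open>p\<close>.\<close>

lemma continuous_on_weighted_param_integral:
  fixes \<nu> :: "'a::metric_space \<Rightarrow> real" and h :: "'a \<Rightarrow> real \<Rightarrow> real"
  assumes S: "compact S" and \<nu>: "continuous_on S \<nu>" "\<And>p. p \<in> S \<Longrightarrow> 0 < \<nu> p"
    and h: "continuous_on (S \<times> {0..1}) (\<lambda>(p, s). h p s)"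
  shows "continuous_on S (\<lambda>p. LINT s:{0..1}|lebesgue. s powr (\<nu> p - 1) * h p s)"
proof (cases "S = {}")
  case False
  then obtain p0 where p0: "p0 \<in> S" "\<And>p. p \<in> S \<Longrightarrow> \<nu> p0 \<le> \<nu> p"
    using continuous_attains_inf[OF S False \<nu>(1)] by auto
  have "bounded ((\<lambda>(p, s). h p s) ` (S \<times> {0..1}))"
    by (intro compact_imp_bounded compact_continuous_image h compact_Times S) auto
  then obtain M where M: "\<And>p s. p \<in> S \<Longrightarrow> s \<in> {0..1} \<Longrightarrow> \<bar>h p s\<bar> \<le> M"
    unfolding bounded_iff by fastforce
  have hp: "continuous_on {0..1} (h p)" if "p \<in> S" for p
    using continuous_on_compose2[OF h, of "{0..1}" "\<lambda>s. (p, s)"] that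
    by (force intro: continuous_intros)
  have int: "(\<lambda>s. s powr (\<nu> p - 1) * h p s) absolutely_integrable_on {0..1}" if "p \<in> S" for p
    by (rule absolutely_integrable_continuous_mult[OF hp[OF that]])
      (use powr_absolutely_integrable(1)[of "\<nu> p - 1" 1] \<nu>(2)[OF that] in auto)
  show ?thesis
  proof (rule continuous_on_sequentiallyI)
    fix p a assume p: "\<forall>n. p n \<in> S" and a: "a \<in> S" and lim: "p \<longlonglongrightarrow> a"
    have \<nu>lim: "(\<lambda>n. \<nu> (p n)) \<longlonglongrightarrow> \<nu> a"
      using \<nu>(1) p a lim unfolding continuous_on_sequentially comp_def by auto
    show "(\<lambda>n. LINT s:{0..1}|lebesgue. s powr (\<nu> (p n) - 1) * h (p n) s)
        \<longlonglongrightarrow> (LINT s:{0..1}|lebesgue. s powr (\<nu> a - 1) * h a s)"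
      unfolding set_lebesgue_integral_def
    proof (rule integral_dominated_convergence[where w="\<lambda>s. indicator {0..1} s *\<^sub>R (s powr (\<nu> p0 - 1) * M)"])
      show "integrable lebesgue (\<lambda>s. indicator {0..1} s *\<^sub>R (s powr (\<nu> p0 - 1) * M))"
        using powr_absolutely_integrable(1)[of "\<nu> p0 - 1" 1] \<nu>(2)[OF p0(1)]
        unfolding set_integrable_def[symmetric] by (intro set_integrable_mult_left) auto
      show "(\<lambda>s. indicator {0..1} s *\<^sub>R (s powr (\<nu> a - 1) * h a s)) \<in> borel_measurable lebesgue"
        using int[OF a] unfolding set_integrable_def by (rule borel_measurable_integrable)
      show "(\<lambda>s. indicator {0..1} s *\<^sub>R (s powr (\<nu> (p n) - 1) * h (p n) s)) \<in> borel_measurable lebesgue" for n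
        using int[of "p n"] p unfolding set_integrable_def by (auto intro: borel_measurable_integrable)
      show "AE s in lebesgue. (\<lambda>n. indicator {0..1} s *\<^sub>R (s powr (\<nu> (p n) - 1) * h (p n) s))
          \<longlonglongrightarrow> indicator {0..1} s *\<^sub>R (s powr (\<nu> a - 1) * h a s)"
      proof (intro AE_I2)
        fix s :: real
        show "(\<lambda>n. indicator {0..1} s *\<^sub>R (s powr (\<nu> (p n) - 1) * h (p n) s))
          \<longlonglongrightarrow> indicator {0..1} s *\<^sub>R (s powr (\<nu> a - 1) * h a s)"
        proof (cases "s \<in> {0..1}")
          case s: True
          have "(\<lambda>n. (p n, s)) \<longlonglongrightarrow> (a, s)" by (intro tendsto_intros lim)
          then have "(\<lambda>n. h (p n) s) \<longlonglongrightarrow> h a s"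
            using h p a s unfolding continuous_on_sequentially comp_def
            by (auto dest!: spec[where x="\<lambda>n. (p n, s)"])
          \<comment> \<open>At \<open>s = 0\<close> the convention \<open>0 powr a = 0\<close> makes
            the sequence constant; elsewhere the power is continuous in its exponent.\<close>
          moreover have "(\<lambda>n. s powr (\<nu> (p n) - 1)) \<longlonglongrightarrow> s powr (\<nu> a - 1)"
            by (cases "s = 0") (auto intro!: tendsto_intros \<nu>lim)
          ultimately show ?thesis by (intro tendsto_scaleR tendsto_mult tendsto_const)
        qed simp
      qed
      show "AE s in lebesgue. norm (indicator {0..1} s *\<^sub>R (s powr (\<nu> (p n) - 1) * h (p n) s))
          \<le> indicator {0..1} s *\<^sub>R (s powr (\<nu> p0 - 1) * M)" for n
      proof (intro AE_I2)
        fix s :: real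
        show "norm (indicator {0..1} s *\<^sub>R (s powr (\<nu> (p n) - 1) * h (p n) s))
          \<le> indicator {0..1} s *\<^sub>R (s powr (\<nu> p0 - 1) * M)"
        proof (cases "s \<in> {0..1}")
          case s: True
          have "s powr (\<nu> (p n) - 1) \<le> s powr (\<nu> p0 - 1)"
            using s p0(2)[of "p n"] p by (cases "s = 0") (auto intro!: powr_mono')
          then show ?thesis
            using M[of "p n" s] p s by (auto simp: abs_mult intro!: mult_mono)
        qed simp
      qed
    qed
  qed
qed simp

text \<open>Order, time and integrand may vary together: the integral over the unit interval is
  continuous, \<open>Gamma\<close> is continuous and nonzero at positive orders, and
  \<open>\<tau> powr \<nu>\<close> stays continuous at \<open>\<tau> = 0\<close> because
  \<open>\<nu> > 0\<close>. Taking pairs for \<open>p\<close> gives joint continuity in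
  \<open>(s, \<gamma>)\<close> and in \<open>(x, \<gamma>)\<close>.\<close>

lemma continuous_on_rl_integral:
  fixes \<nu> \<tau> :: "'a::metric_space \<Rightarrow> real" and g :: "'a \<Rightarrow> real \<Rightarrow> real"
  assumes S: "compact S" and \<nu>: "continuous_on S \<nu>" "\<And>p. p \<in> S \<Longrightarrow> 0 < \<nu> p"
    and \<tau>: "continuous_on S \<tau>" "\<And>p. p \<in> S \<Longrightarrow> \<tau> p \<in> {0..T}"
    and g: "continuous_on (S \<times> {0..T}) (\<lambda>(p, s). g p s)"
  shows "continuous_on S (\<lambda>p. rl_integral (\<nu> p) (g p) (\<tau> p))"
proof -
  have m: "\<tau> p * (1 - s) \<in> {0..T}" if "p \<in> S" "s \<in> {0..1}" for p s
    using \<tau>(2)[OF that(1)] that(2) mult_left_le[of "1 - s" "\<tau> p"] by (auto intro: order_trans)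
  have "continuous_on (S \<times> {0..1}) (\<lambda>z. (\<lambda>(p, s). g p s) (fst z, \<tau> (fst z) * (1 - snd z)))"
    by (intro continuous_on_compose2[OF g] continuous_intros continuous_on_compose2[OF \<tau>(1)])
      (use m in auto)
  then have h: "continuous_on (S \<times> {0..1}) (\<lambda>(p, s). g p (\<tau> p * (1 - s)))"
    by (simp add: case_prod_beta)
  have G: "Gamma (\<nu> p) \<noteq> 0" if "p \<in> S" for p
    using Gamma_real_pos[OF \<nu>(2)[OF that]] by simp
  have "continuous_on S (\<lambda>p. \<tau> p powr \<nu> p / Gamma (\<nu> p)
      * (LINT s:{0..1}|lebesgue. s powr (\<nu> p - 1) * g p (\<tau> p * (1 - s))))"
    using \<tau>(2) \<nu>(2) G
    by (intro continuous_on_mult continuous_on_divide continuous_on_weighted_param_integral S \<nu> h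
        continuous_on_powr' \<tau> continuous_on_compose2[OF continuous_on_Gamma \<nu>(1), of "{0<..}"])
      (auto dest: nonpos_Ints_nonpos)
  then show ?thesis
    by (rule continuous_on_eq) (use \<tau>(2) in \<open>simp add: rl_integral_unit\<close>)
qed

text \<open>Meant for products with a negative power of \<open>t - s\<close>, which are evidently
  continuous only for \<open>s < t\<close>. If the other factors compensate the singularity, the
  bound forces the limit 0 at \<open>t\<close>, and at \<open>s = t\<close> itself also the value 0,
  since \<open>0 powr p = 0\<close>.\<close>

lemma continuous_on_Icc_vanishing:
  fixes \<phi> :: "real \<Rightarrow> real"
  assumes c: "continuous_on {0..<t} \<phi>" and p: "0 < p"
    and b: "\<And>s. s \<in> {0..t} \<Longrightarrow> \<bar>\<phi> s\<bar> \<le> K * (t - s) powr p"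
  shows "continuous_on {0..t} \<phi>"
  unfolding continuous_on_eq_continuous_within
proof
  fix s assume s: "s \<in> {0..t}"
  show "continuous (at s within {0..t}) \<phi>"
  proof (cases "s = t")
    case True
    have "continuous_on {0..t} (\<lambda>s. K * (t - s) powr p)"
      using p by (intro continuous_intros continuous_on_powr') auto
    then have "((\<lambda>s. K * (t - s) powr p) \<longlongrightarrow> K * (t - t) powr p) (at t within {0..t})"
      using s True unfolding continuous_on_def by blast
    then have lim: "((\<lambda>s. K * (t - s) powr p) \<longlongrightarrow> 0) (at t within {0..t})" by simp
    have "\<forall>\<^sub>F s in at t within {0..t}. norm (\<phi> s) \<le> K * (t - s) powr p"
      unfolding eventually_at_filter by (rule always_eventually) (use b in auto)
    then have "(\<phi> \<longlongrightarrow> 0) (at t within {0..t})"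
      using lim by (rule Lim_null_comparison)
    moreover have "\<phi> t = 0" using b[OF s] True by simp
    ultimately show ?thesis using True by (simp add: continuous_within)
  next
    case False
    then have "continuous (at s within {0..<t}) \<phi>"
      using s c unfolding continuous_on_eq_continuous_within by simp
    moreover have "at s within {0..<t} = at s within {0..t}"
      by (rule at_within_nhd[where S="{..<t}"]) (use s False in auto)
    ultimately show ?thesis by simp
  qed
qed

text \<open>
  With \<open>z s = v t - v s\<close> the integrand is \<open>- (z\<^sup>2)' (t - s)\<^bsup>- \<theta>\<^esup>\<close>; it differs from
  \<open>- (z\<^sup>2 (t - s)\<^bsup>- \<theta>\<^esup>)'\<close> by the nonnegative term \<open>\<theta> z\<^sup>2 (t - s)\<^bsup>- \<theta> - 1\<^esup>\<close>.
\<close>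

lemma caputo_square_defect_nonneg:
  fixes v v' :: "real \<Rightarrow> real"
  assumes \<theta>: "0 < \<theta>" "\<theta> < 1" and t: "0 < t"
    and v: "\<And>s. s \<in> {0..t} \<Longrightarrow> (v has_real_derivative v' s) (at s within {0..t})"
    and v': "continuous_on {0..t} v'"
  shows "0 \<le> (LINT s:{0..t}|lebesgue. (t - s) powr (- \<theta>) * (2 * (v t - v s) * v' s))"
proof -
  let ?I = "\<lambda>s. (t - s) powr (- \<theta>) * (2 * (v t - v s) * v' s)"
  let ?F = "\<lambda>s. (v t - v s)\<^sup>2 * (t - s) powr (- \<theta>)"
  have "bounded (v' ` {0..t})"
    by (intro compact_imp_bounded compact_continuous_image v') auto
  then obtain M where M: "\<And>s. s \<in> {0..t} \<Longrightarrow> \<bar>v' s\<bar> \<le> M"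
    unfolding bounded_iff by fastforce
  have M0: "0 \<le> M" using M[of 0] t by auto
  \<comment> \<open>This Lipschitz bound beats the kernel: \<open>?I\<close> is of order
    \<open>(t - s) powr (1 - \<theta>)\<close> and \<open>?F\<close> of order
    \<open>(t - s) powr (2 - \<theta>)\<close>, so both are continuous up to
    \<open>t\<close>.\<close>
  have z: "\<bar>v t - v s\<bar> \<le> M * (t - s)" if "s \<in> {0..t}" for s
    using field_differentiable_bound[of "{0..t}" v v' M t s] v M that t by auto
  have vc: "continuous_on {0..t} v"
    using v by (meson DERIV_continuous_on)
  have Ic: "continuous_on {0..t} ?I"
  proof (rule continuous_on_Icc_vanishing[where p="1 - \<theta>" and K="2 * M * M"])
    show "continuous_on {0..<t} ?I"
      by (intro continuous_intros continuous_on_subset[OF vc] continuous_on_subset[OF v']) auto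
    fix s assume s: "s \<in> {0..t}"
    have "\<bar>?I s\<bar> = (t - s) powr (- \<theta>) * (2 * \<bar>v t - v s\<bar> * \<bar>v' s\<bar>)"
      unfolding abs_mult by simp
    also have "\<dots> \<le> (t - s) powr (- \<theta>) * (2 * (M * (t - s)) * M)"
      using s M0 z[OF s] M[OF s] by (intro mult_left_mono mult_mono) auto
    also have "\<dots> = 2 * M * M * (t - s) powr (1 - \<theta>)"
      using s by (cases "s = t") (auto simp: powr_diff powr_minus field_simps)
    finally show "\<bar>?I s\<bar> \<le> 2 * M * M * (t - s) powr (1 - \<theta>)" .
  qed (use \<theta> in simp)
  have Fc: "continuous_on {0..t} ?F"
  proof (rule continuous_on_Icc_vanishing[where p="2 - \<theta>" and K="M * M"])
    show "continuous_on {0..<t} ?F"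
      by (intro continuous_intros continuous_on_subset[OF vc]) auto
    fix s assume s: "s \<in> {0..t}"
    have "\<bar>?F s\<bar> = \<bar>v t - v s\<bar> * \<bar>v t - v s\<bar> * (t - s) powr (- \<theta>)"
      by (simp add: abs_mult power2_eq_square)
    also have "\<dots> \<le> (M * (t - s)) * (M * (t - s)) * (t - s) powr (- \<theta>)"
      using s M0 z[OF s] by (intro mult_right_mono mult_mono) auto
    also have "\<dots> = M * M * (t - s) powr (2 - \<theta>)"
      using s by (cases "s = t") (auto simp: powr_diff powr_minus field_simps powr_numeral power2_eq_square)
    finally show "\<bar>?F s\<bar> \<le> M * M * (t - s) powr (2 - \<theta>)" .
  qed (use \<theta> in simp)
  \<comment> \<open>The derivative of \<open>?H\<close> is exactly the nonnegative difference term,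
    so \<open>?H\<close> is nondecreasing. As \<open>?F t = 0\<close>, this gives
    \<open>0 \<le> ?F 0 = ?H 0 \<le> ?H t = integral {0..t} ?I\<close>.\<close>
  let ?H = "\<lambda>\<tau>. integral {0..\<tau>} ?I + ?F \<tau>"
  have "?H 0 \<le> ?H t"
  proof (rule DERIV_nonneg_imp_increasing_open[of 0 t ?H])
    show "continuous_on {0..t} ?H"
      by (intro continuous_on_add Fc indefinite_integral_continuous_1 integrable_continuous_real Ic)
    fix s assume s: "0 < s" "s < t"
    have at: "at s within {0..t} = at s" using s by (intro at_within_interior) simp
    have dv: "(v has_real_derivative v' s) (at s)" using v[of s] s at by simp
    have dI: "((\<lambda>\<tau>. integral {0..\<tau>} ?I) has_real_derivative ?I s) (at s)"
      using integral_has_real_derivative[OF Ic, of s] s at by simp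
    have dF: "(?F has_real_derivative (2 * (v t - v s) * (- v' s)) * (t - s) powr (- \<theta>)
        + (v t - v s)\<^sup>2 * (\<theta> * (t - s) powr (- \<theta> - 1))) (at s)"
      using s by (auto intro!: derivative_eq_intros dv simp: algebra_simps)
    have "(?H has_real_derivative \<theta> * ((v t - v s)\<^sup>2 * (t - s) powr (- \<theta> - 1))) (at s)"
      using DERIV_add[OF dI dF] by (simp add: algebra_simps)
    then show "\<exists>y. (?H has_real_derivative y) (at s) \<and> 0 \<le> y"
      using \<theta> by (intro exI conjI) auto
  qed (use t in simp)
  moreover have "0 \<le> ?F 0" "?F t = 0" "integral {0..0} ?I = 0" by simp_all
  ultimately have "0 \<le> integral {0..t} ?I" by linarith
  then show ?thesis by (simp only: set_lebesgue_integral_continuous[OF Ic])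
qed

text \<open>After reflection, the double integral of
  \<open>\<tau> powr (\<nu> - 1) * w' (s - \<tau>)\<close> is taken first over \<open>s\<close>,
  where the fundamental theorem leaves \<open>w (t - \<tau>) - w 0\<close>. The first term is the
  fractional integral of \<open>w\<close>; the second carries the kernel integral
  \<open>t powr \<nu> / \<nu>\<close>, and
  \<open>\<nu> * Gamma \<nu> = Gamma (\<nu> + 1)\<close>.\<close>

lemma set_integral_rl_integral_derivative:
  fixes w w' :: "real \<Rightarrow> real"
  assumes \<nu>: "0 < \<nu>" and t: "0 \<le> t"
    and w: "\<And>s. s \<in> {0..t} \<Longrightarrow> (w has_real_derivative w' s) (at s within {0..t})"
    and w': "continuous_on {0..t} w'"
  shows "(LINT s:{0..t}|lebesgue. rl_integral \<nu> w' s)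
    = rl_integral \<nu> w t - w 0 * t powr \<nu> / Gamma (\<nu> + 1)"
proof -
  \<comment> \<open>Extension by 0 turns the triangle \<open>\<tau> \<le> s\<close> into a square
    with constant limits. \<open>C\<close> may jump across the diagonal, but it is continuous on the
    closed triangle and hence Borel.\<close>
  define C where "C s \<tau> = (if \<tau> \<le> s then w' (s - \<tau>) else 0)" for s \<tau>
  define k where "k \<tau> = \<tau> powr (\<nu> - 1)" for \<tau> :: real
  have k: "k absolutely_integrable_on {0..t}" and k_int: "(LINT \<tau>:{0..t}|lebesgue. k \<tau>) = t powr \<nu> / \<nu>"
    using powr_absolutely_integrable[of "\<nu> - 1" t] \<nu> t by (simp_all add: k_def[abs_def])
  have wc: "continuous_on {0..t} w"
    using w by (meson DERIV_continuous_on)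
  have "bounded (w' ` {0..t})"
    by (intro compact_imp_bounded compact_continuous_image w') auto
  then obtain M where M: "\<And>s. s \<in> {0..t} \<Longrightarrow> \<bar>w' s\<bar> \<le> M"
    unfolding bounded_iff by fastforce
  have Cb: "\<bar>C s \<tau>\<bar> \<le> M" if "s \<in> {0..t}" "\<tau> \<in> {0..t}" for s \<tau>
    using M[of 0] M[of "s - \<tau>"] that by (auto simp: C_def)
  let ?D = "{0..t} \<times> {0..t} \<inter> {p. snd p \<le> fst p}"
  have "(\<lambda>p. indicator ?D p *\<^sub>R w' (fst p - snd p)) \<in> borel_measurable borel"
    by (intro borel_measurable_continuous_on_indicator borel_closed closed_Int closed_Times
        closed_Collect_le continuous_intros continuous_on_compose2[OF w']) auto
  moreover have "(\<lambda>p. indicator ?D p *\<^sub>R w' (fst p - snd p))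
      = (\<lambda>(s, \<tau>). indicator ({0..t} \<times> {0..t}) (s, \<tau>) * C s \<tau>)"
    by (auto simp: C_def indicator_def fun_eq_iff)
  ultimately have Cm: "(\<lambda>(s, \<tau>). indicator ({0..t} \<times> {0..t}) (s, \<tau>) * C s \<tau>) \<in> borel_measurable borel"
    by simp
  have rl: "rl_integral \<nu> w' s = 1 / Gamma \<nu> * (LINT \<tau>:{0..t}|lebesgue. k \<tau> * C s \<tau>)" if "s \<in> {0..t}" for s
    unfolding rl_integral_reflect set_lebesgue_integral_def
    by (intro arg_cong2[where f="(*)"] refl Bochner_Integration.integral_cong)
      (use that in \<open>auto simp: indicator_def C_def k_def\<close>)
  have inner: "(LINT s:{0..t}|lebesgue. C s \<tau>) = w (t - \<tau>) - w 0" if \<tau>: "\<tau> \<in> {0..t}" for \<tau>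
  proof -
    have c: "continuous_on {\<tau>..t} (\<lambda>s. w' (s - \<tau>))"
      by (intro continuous_on_compose2[OF w'] continuous_intros) (use \<tau> in auto)
    have "((\<lambda>s. w' (s - \<tau>)) has_integral (w (t - \<tau>) - w (\<tau> - \<tau>))) {\<tau>..t}"
    proof (rule fundamental_theorem_of_calculus)
      fix s assume s: "s \<in> {\<tau>..t}"
      have "((\<lambda>s. w (s - \<tau>)) has_real_derivative w' (s - \<tau>) * 1) (at s within {\<tau>..t})"
        by (rule DERIV_image_chain[of w _ "\<lambda>s. s - \<tau>", unfolded o_def])
          (use s \<tau> in \<open>auto intro!: derivative_eq_intros DERIV_subset[OF w]\<close>)
      then show "((\<lambda>s. w (s - \<tau>)) has_vector_derivative w' (s - \<tau>)) (at s within {\<tau>..t})"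
        by (simp add: has_real_derivative_iff_has_vector_derivative)
    qed (use \<tau> in simp)
    then have "(LINT s:{\<tau>..t}|lebesgue. w' (s - \<tau>)) = w (t - \<tau>) - w 0"
      by (simp add: set_lebesgue_integral_continuous[OF c] integral_unique)
    moreover have "(LINT s:{0..t}|lebesgue. C s \<tau>) = (LINT s:{\<tau>..t}|lebesgue. w' (s - \<tau>))"
      unfolding set_lebesgue_integral_def
      by (rule Bochner_Integration.integral_cong) (use \<tau> in \<open>auto simp: indicator_def C_def\<close>)
    ultimately show ?thesis by simp
  qed
  have \<Gamma>: "Gamma (\<nu> + 1) = \<nu> * Gamma \<nu>"
    using \<nu> by (intro Gamma_plus1) (auto dest: nonpos_Ints_nonpos)
  have kw: "(\<lambda>\<tau>. k \<tau> * w (t - \<tau>)) absolutely_integrable_on {0..t}"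
    by (rule absolutely_integrable_continuous_mult[OF _ k])
      (auto intro!: continuous_on_compose2[OF wc] continuous_intros)
  have "(LINT s:{0..t}|lebesgue. rl_integral \<nu> w' s)
      = (LINT s:{0..t}|lebesgue. 1 / Gamma \<nu> * (LINT \<tau>:{0..t}|lebesgue. k \<tau> * C s \<tau>))"
    unfolding set_lebesgue_integral_def[of _ "{0..t}" "rl_integral \<nu> w'"]
      set_lebesgue_integral_def[of _ "{0..t}" "\<lambda>s. 1 / Gamma \<nu> * _ s"]
    by (rule Bochner_Integration.integral_cong) (auto simp: indicator_def rl)
  also have "\<dots> = 1 / Gamma \<nu> * (LINT \<tau>:{0..t}|lebesgue. k \<tau> * (LINT s:{0..t}|lebesgue. C s \<tau>))"
    by (simp only: set_integral_mult_right set_integral_weighted_swap(2)[OF k Cm Cb])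
  also have "(LINT \<tau>:{0..t}|lebesgue. k \<tau> * (LINT s:{0..t}|lebesgue. C s \<tau>))
      = (LINT \<tau>:{0..t}|lebesgue. k \<tau> * w (t - \<tau>) - k \<tau> * w 0)"
    by (rule set_lebesgue_integral_cong) (auto simp: inner right_diff_distrib)
  also have "\<dots> = (LINT \<tau>:{0..t}|lebesgue. k \<tau> * w (t - \<tau>)) - t powr \<nu> / \<nu> * w 0"
    using set_integral_diff(2)[OF kw set_integrable_mult_left[OF k]] by (simp add: k_int)
  finally show ?thesis
    using \<nu> Gamma_real_pos[OF \<nu>] \<Gamma>
    by (simp add: rl_integral_reflect[of \<nu> w] k_def diff_divide_distrib right_diff_distrib mult.commute)
qed

section \<open>The distributed-order energy in time\<close>

lemma set_integral_finite_sum: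
  fixes f :: "'i \<Rightarrow> 'a \<Rightarrow> real"
  assumes "\<And>i. i \<in> I \<Longrightarrow> set_integrable M A (f i)"
  shows "set_integrable M A (\<lambda>x. \<Sum>i\<in>I. f i x)"
    and "(LINT x:A|M. \<Sum>i\<in>I. f i x) = (\<Sum>i\<in>I. LINT x:A|M. f i x)"
  using assms unfolding set_integrable_def set_lebesgue_integral_def
  by (simp_all add: sum_distrib_left)

text \<open>The integral already known to be nonnegative has the factor
  \<open>2 * (v s - v x) * v' x\<close>, which is \<open>2 * v s * v' x\<close> minus the derivative
  of the square of \<open>v\<close>. Division by \<open>Gamma (1 - \<theta>) > 0\<close> then
  compares the two Caputo derivatives.\<close>

lemma caputo_square_le:
  fixes v v' :: "real \<Rightarrow> real"
  assumes \<theta>: "0 < \<theta>" "\<theta> < 1" and s: "0 < s"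
    and v: "\<And>x. x \<in> {0..s} \<Longrightarrow> (v has_real_derivative v' x) (at x within {0..s})"
    and v': "continuous_on {0..s} v'"
  shows "rl_integral (1 - \<theta>) (\<lambda>x. 2 * v x * v' x) s \<le> 2 * v s * rl_integral (1 - \<theta>) v' s"
proof -
  have vc: "continuous_on {0..s} v"
    using v by (meson DERIV_continuous_on)
  define k where "k x = (s - x) powr (1 - \<theta> - 1)" for x
  have i1: "(\<lambda>x. k x * v' x) absolutely_integrable_on {0..s}"
    and i2: "(\<lambda>x. k x * (2 * v x * v' x)) absolutely_integrable_on {0..s}"
    unfolding k_def by (intro rl_kernel_integrable continuous_intros v' vc; use \<theta> in simp)+
  have "0 \<le> (LINT x:{0..s}|lebesgue. k x * (2 * (v s - v x) * v' x))"
    using caputo_square_defect_nonneg[OF \<theta> s v v'] by (simp add: k_def)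
  also have "\<dots> = (LINT x:{0..s}|lebesgue. 2 * v s * (k x * v' x) - k x * (2 * v x * v' x))"
    by (intro set_lebesgue_integral_cong) (auto simp: algebra_simps)
  also have "\<dots> = 2 * v s * (LINT x:{0..s}|lebesgue. k x * v' x)
      - (LINT x:{0..s}|lebesgue. k x * (2 * v x * v' x))"
    using i1 i2 by (subst set_integral_diff(2)) auto
  finally have "(LINT x:{0..s}|lebesgue. k x * (2 * v x * v' x))
      \<le> 2 * v s * (LINT x:{0..s}|lebesgue. k x * v' x)" by simp
  moreover have "0 < Gamma (1 - \<theta>)"
    using \<theta> by (intro Gamma_real_pos) simp
  ultimately show ?thesis
    by (simp add: rl_integral_def k_def divide_right_mono)
qed

text \<open>The position \<open>x\<close> is frozen. The convexity inequality is applied order by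
  order, weighted with \<open>\<omega>\<close> and integrated in \<open>s\<close>; exchanging the
  integrals in \<open>s\<close> and \<open>\<gamma>\<close> leaves an exact identity for each order.
  \<open>G\<close> stands for the right-hand side of the equation, which is given for
  \<open>s > 0\<close>.\<close>

lemma distributed_energy_time_inequality:
  fixes v v' G :: "real \<Rightarrow> real" and \<theta> \<omega> :: "nat \<Rightarrow> real \<Rightarrow> real"
  assumes t: "0 < t"
    and v: "\<And>s. s \<in> {0..t} \<Longrightarrow> (v has_real_derivative v' s) (at s within {0..t})"
    and v': "continuous_on {0..t} v'"
    and \<theta>: "\<And>r. r \<in> {1..m} \<Longrightarrow> continuous_on {\<alpha>..\<beta>} (\<theta> r)"
    and \<theta>01: "\<And>r \<gamma>. r \<in> {1..m} \<Longrightarrow> \<gamma> \<in> {\<alpha>..\<beta>} \<Longrightarrow> 0 < \<theta> r \<gamma> \<and> \<theta> r \<gamma> < 1"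
    and \<omega>0: "\<And>r \<gamma>. r \<in> {1..m} \<Longrightarrow> \<gamma> \<in> {\<alpha>..\<beta>} \<Longrightarrow> 0 \<le> \<omega> r \<gamma>"
    and \<omega>: "\<And>r. r \<in> {1..m} \<Longrightarrow> \<omega> r absolutely_integrable_on {\<alpha>..\<beta>}"
    and G: "continuous_on {0..t} G"
    and eq: "\<And>s. s \<in> {0<..t} \<Longrightarrow>
      (LINT \<gamma>:{\<alpha>..\<beta>}|lebesgue. \<Sum>r=1..m. \<omega> r \<gamma> * caputo (\<theta> r \<gamma>) v s) = G s"
  shows "(LINT \<gamma>:{\<alpha>..\<beta>}|lebesgue. \<Sum>r=1..m. \<omega> r \<gamma> * rl_integral (1 - \<theta> r \<gamma>) (\<lambda>s. (v s)\<^sup>2) t)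
     - (v 0)\<^sup>2 * (LINT \<gamma>:{\<alpha>..\<beta>}|lebesgue. \<Sum>r=1..m. \<omega> r \<gamma> * t powr (1 - \<theta> r \<gamma>) / Gamma (2 - \<theta> r \<gamma>))
     \<le> integral {0..t} (\<lambda>s. 2 * v s * G s)"
proof -
  have vc: "continuous_on {0..t} v"
    using v by (meson DERIV_continuous_on)
  define w' where "w' s = 2 * v s * v' s" for s
  have w'c: "continuous_on {0..t} w'"
    unfolding w'_def by (intro continuous_intros vc v')
  have w: "((\<lambda>s. (v s)\<^sup>2) has_real_derivative w' s) (at s within {0..t})" if "s \<in> {0..t}" for s
    using v[OF that] unfolding w'_def by (auto intro!: derivative_eq_intros)
  define K where "K r s \<gamma> = rl_integral (1 - \<theta> r \<gamma>) v' s" for r s \<gamma>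
  define C where "C r s \<gamma> = rl_integral (1 - \<theta> r \<gamma>) w' s" for r s \<gamma>
  have cont: "continuous_on ({0..t} \<times> {\<alpha>..\<beta>}) (\<lambda>(s, \<gamma>). rl_integral (1 - \<theta> r \<gamma>) g s)"
    if r: "r \<in> {1..m}" and g: "continuous_on {0..t} g" for r g
  proof -
    have "continuous_on ({0..t} \<times> {\<alpha>..\<beta>}) (\<lambda>p. rl_integral (1 - \<theta> r (snd p)) ((\<lambda>_. g) p) (fst p))"
      by (rule continuous_on_rl_integral[where T=t])
        (use \<theta>01[OF r] in \<open>auto simp: case_prod_beta
          intro!: compact_Times continuous_intros continuous_on_compose2[OF \<theta>[OF r]] continuous_on_compose2[OF g]\<close>)
    then show ?thesis by (simp add: case_prod_beta)
  qed
  have cont_slice: "continuous_on {\<alpha>..\<beta>} (\<lambda>\<gamma>. rl_integral (1 - \<theta> r \<gamma>) g s)"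
    if "r \<in> {1..m}" "continuous_on {0..t} g" "s \<in> {0..t}" for r g s
    using continuous_on_compose2[OF cont[OF that(1,2)], of "{\<alpha>..\<beta>}" "\<lambda>\<gamma>. (s, \<gamma>)"] that(3)
    by (force intro: continuous_intros)
  have iK: "(\<lambda>\<gamma>. \<omega> r \<gamma> * K r s \<gamma>) absolutely_integrable_on {\<alpha>..\<beta>}"
    and iC: "(\<lambda>\<gamma>. \<omega> r \<gamma> * C r s \<gamma>) absolutely_integrable_on {\<alpha>..\<beta>}"
    if "r \<in> {1..m}" "s \<in> {0..t}" for r s
    unfolding K_def C_def
    by (intro absolutely_integrable_continuous_mult cont_slice \<omega> that v' w'c)+
  have swap: "(\<lambda>s. LINT \<gamma>:{\<alpha>..\<beta>}|lebesgue. \<omega> r \<gamma> * C r s \<gamma>) absolutely_integrable_on {0..t}"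
    "(LINT s:{0..t}|lebesgue. LINT \<gamma>:{\<alpha>..\<beta>}|lebesgue. \<omega> r \<gamma> * C r s \<gamma>)
      = (LINT \<gamma>:{\<alpha>..\<beta>}|lebesgue. \<omega> r \<gamma> * (LINT s:{0..t}|lebesgue. C r s \<gamma>))"
    if r: "r \<in> {1..m}" for r
  proof -
    have c: "continuous_on ({0..t} \<times> {\<alpha>..\<beta>}) (\<lambda>(s, \<gamma>). C r s \<gamma>)"
      unfolding C_def by (rule cont[OF r w'c])
    obtain M where M: "\<And>s \<gamma>. s \<in> {0..t} \<Longrightarrow> \<gamma> \<in> {\<alpha>..\<beta>} \<Longrightarrow> \<bar>C r s \<gamma>\<bar> \<le> M"
      using bounded_continuous_rect[OF c] by blast
    have "(\<lambda>p. indicator ({0..t} \<times> {\<alpha>..\<beta>}) p *\<^sub>R (\<lambda>(s, \<gamma>). C r s \<gamma>) p) \<in> borel_measurable borel"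
      by (intro borel_measurable_continuous_on_indicator c borel_closed closed_Times) auto
    moreover have "(\<lambda>p. indicator ({0..t} \<times> {\<alpha>..\<beta>}) p *\<^sub>R (\<lambda>(s, \<gamma>). C r s \<gamma>) p)
        = (\<lambda>(s, \<gamma>). indicator ({0..t} \<times> {\<alpha>..\<beta>}) (s, \<gamma>) * C r s \<gamma>)"
      by (auto simp: fun_eq_iff)
    ultimately have m: "(\<lambda>(s, \<gamma>). indicator ({0..t} \<times> {\<alpha>..\<beta>}) (s, \<gamma>) * C r s \<gamma>) \<in> borel_measurable borel"
      by simp
    show "(\<lambda>s. LINT \<gamma>:{\<alpha>..\<beta>}|lebesgue. \<omega> r \<gamma> * C r s \<gamma>) absolutely_integrable_on {0..t}"
      by (rule set_integral_weighted_swap(1)[OF \<omega>[OF r] m M])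
    show "(LINT s:{0..t}|lebesgue. LINT \<gamma>:{\<alpha>..\<beta>}|lebesgue. \<omega> r \<gamma> * C r s \<gamma>)
      = (LINT \<gamma>:{\<alpha>..\<beta>}|lebesgue. \<omega> r \<gamma> * (LINT s:{0..t}|lebesgue. C r s \<gamma>))"
      by (rule set_integral_weighted_swap(2)[OF \<omega>[OF r] m M])
  qed
  \<comment> \<open>\<open>g\<close> is \<open>2 * v\<close> times the distributed Caputo derivative
    of \<open>v\<close>, and \<open>c\<close> is that of the square of \<open>v\<close>. The aim is
    \<open>c \<le> g\<close>, with the integral of \<open>g\<close> known from the equation and that
    of \<open>c\<close> from the exchange.\<close>
  define g where "g s = 2 * v s * (\<Sum>r=1..m. LINT \<gamma>:{\<alpha>..\<beta>}|lebesgue. \<omega> r \<gamma> * K r s \<gamma>)" for s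
  define c where "c s = (\<Sum>r=1..m. LINT \<gamma>:{\<alpha>..\<beta>}|lebesgue. \<omega> r \<gamma> * C r s \<gamma>)" for s
  have g_eq: "g s = 2 * v s * G s" if s: "s \<in> {0<..t}" for s
  proof -
    have cap: "caputo (\<theta> r \<gamma>) v s = K r s \<gamma>" if r: "r \<in> {1..m}" and \<gamma>: "\<gamma> \<in> {\<alpha>..\<beta>}" for r \<gamma>
      unfolding K_def
    proof (rule caputo_eq_rl_integral)
      show "continuous_on {0..s} v'" by (rule continuous_on_subset[OF v']) (use s in auto)
      fix x assume x: "x \<in> {0<..<s}"
      then have "at x within {0..t} = at x" using s by (intro at_within_interior) simp
      then show "deriv v x = v' x" using v[of x] x s by (intro DERIV_imp_deriv) simp
    qed (use \<theta>01[OF r \<gamma>] in simp)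
    have "G s = (LINT \<gamma>:{\<alpha>..\<beta>}|lebesgue. \<Sum>r=1..m. \<omega> r \<gamma> * K r s \<gamma>)"
      unfolding eq[OF s, symmetric] by (intro set_lebesgue_integral_cong) (auto simp: cap)
    also have "\<dots> = (\<Sum>r=1..m. LINT \<gamma>:{\<alpha>..\<beta>}|lebesgue. \<omega> r \<gamma> * K r s \<gamma>)"
      using s by (intro set_integral_finite_sum(2) iK) auto
    finally show ?thesis by (simp add: g_def)
  qed
  \<comment> \<open>Integrability of \<open>g\<close> is read off from the equation: away from
    \<open>s = 0\<close> it equals a continuous function.\<close>
  have g_int: "g absolutely_integrable_on {0..t}"
    and g_G: "(LINT s:{0..t}|lebesgue. g s) = integral {0..t} (\<lambda>s. 2 * v s * G s)"
  proof -
    have cont: "continuous_on {0..t} (\<lambda>s. 2 * v s * G s)" by (intro continuous_intros vc G)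
    note spike = absolutely_integrable_spike_finite[OF absolutely_integrable_continuous_real[OF cont],
        where F="{0}" and f=g]
    show "g absolutely_integrable_on {0..t}" by (rule spike(1)) (auto intro!: g_eq)
    have "(LINT s:{0..t}|lebesgue. g s) = (LINT s:{0..t}|lebesgue. 2 * v s * G s)"
      by (rule spike(2)) (auto intro!: g_eq)
    then show "(LINT s:{0..t}|lebesgue. g s) = integral {0..t} (\<lambda>s. 2 * v s * G s)"
      by (simp only: set_lebesgue_integral_continuous[OF cont])
  qed
  have c_le: "c s \<le> g s" if s: "s \<in> {0..t}" for s
  proof (cases "s = 0")
    \<comment> \<open>Both sides vanish here, a fractional integral over a single point being
      0.\<close>
    case True
    then show ?thesis by (simp add: c_def g_def C_def K_def rl_integral_unit[of 0])
  next
    case False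
    have "(LINT \<gamma>:{\<alpha>..\<beta>}|lebesgue. \<omega> r \<gamma> * C r s \<gamma>)
        \<le> 2 * v s * (LINT \<gamma>:{\<alpha>..\<beta>}|lebesgue. \<omega> r \<gamma> * K r s \<gamma>)" if r: "r \<in> {1..m}" for r
    proof -
      have "C r s \<gamma> \<le> 2 * v s * K r s \<gamma>" if \<gamma>: "\<gamma> \<in> {\<alpha>..\<beta>}" for \<gamma>
        unfolding C_def K_def w'_def
        by (rule caputo_square_le)
          (use \<theta>01[OF r \<gamma>] s False in \<open>auto intro!: DERIV_subset[OF v] continuous_on_subset[OF v']\<close>)
      then have "\<omega> r \<gamma> * C r s \<gamma> \<le> 2 * v s * (\<omega> r \<gamma> * K r s \<gamma>)" if "\<gamma> \<in> {\<alpha>..\<beta>}" for \<gamma>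
        using mult_left_mono[OF _ \<omega>0[OF r that]] that by (simp add: mult.left_commute)
      then have "(LINT \<gamma>:{\<alpha>..\<beta>}|lebesgue. \<omega> r \<gamma> * C r s \<gamma>)
        \<le> (LINT \<gamma>:{\<alpha>..\<beta>}|lebesgue. 2 * v s * (\<omega> r \<gamma> * K r s \<gamma>))"
        by (intro set_integral_mono set_integrable_mult_right iC iK r s)
      then show ?thesis by (simp only: set_integral_mult_right)
    qed
    then show ?thesis
      unfolding c_def g_def sum_distrib_left by (intro sum_mono) auto
  qed
  have rl2: "continuous_on {\<alpha>..\<beta>} (\<lambda>\<gamma>. rl_integral (1 - \<theta> r \<gamma>) (\<lambda>s. (v s)\<^sup>2) t)" if "r \<in> {1..m}" for r
    using t by (intro cont_slice that continuous_intros vc) auto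
  have wt: "continuous_on {\<alpha>..\<beta>} (\<lambda>\<gamma>. t powr (1 - \<theta> r \<gamma>) / Gamma (2 - \<theta> r \<gamma>))" if r: "r \<in> {1..m}" for r
  proof -
    have "Gamma (2 - \<theta> r \<gamma>) \<noteq> 0" if "\<gamma> \<in> {\<alpha>..\<beta>}" for \<gamma>
      using Gamma_real_pos[of "2 - \<theta> r \<gamma>"] \<theta>01[OF r that] by linarith
    then show ?thesis
      using t \<theta>01[OF r]
      by (intro continuous_intros \<theta> r continuous_on_compose2[OF continuous_on_Gamma, of "{0<..}" _ "\<lambda>\<gamma>. 2 - \<theta> r \<gamma>"])
        (fastforce dest: nonpos_Ints_nonpos)+
  qed
  \<comment> \<open>With \<open>\<nu> = 1 - \<theta>\<close>, the factor
    \<open>Gamma (\<nu> + 1)\<close> becomes the \<open>Gamma (2 - \<theta>)\<close> of the initial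
    term.\<close>
  have int_c: "(LINT s:{0..t}|lebesgue. C r s \<gamma>)
      = rl_integral (1 - \<theta> r \<gamma>) (\<lambda>s. (v s)\<^sup>2) t - (v 0)\<^sup>2 * (t powr (1 - \<theta> r \<gamma>) / Gamma (2 - \<theta> r \<gamma>))"
    if "r \<in> {1..m}" "\<gamma> \<in> {\<alpha>..\<beta>}" for r \<gamma>
    using set_integral_rl_integral_derivative[OF _ _ w w'c, of "1 - \<theta> r \<gamma>"] t \<theta>01[OF that]
    by (simp add: C_def)
  have "(LINT s:{0..t}|lebesgue. c s)
      = (\<Sum>r=1..m. LINT \<gamma>:{\<alpha>..\<beta>}|lebesgue. \<omega> r \<gamma> * (LINT s:{0..t}|lebesgue. C r s \<gamma>))"
    unfolding c_def by (subst set_integral_finite_sum(2)) (simp_all add: swap)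
  also have "\<dots> = (\<Sum>r=1..m. (LINT \<gamma>:{\<alpha>..\<beta>}|lebesgue. \<omega> r \<gamma> * rl_integral (1 - \<theta> r \<gamma>) (\<lambda>s. (v s)\<^sup>2) t)
      - (v 0)\<^sup>2 * (LINT \<gamma>:{\<alpha>..\<beta>}|lebesgue. \<omega> r \<gamma> * (t powr (1 - \<theta> r \<gamma>) / Gamma (2 - \<theta> r \<gamma>))))"
  proof (rule sum.cong[OF refl])
    fix r assume r: "r \<in> {1..m}"
    let ?a = "\<lambda>\<gamma>. \<omega> r \<gamma> * rl_integral (1 - \<theta> r \<gamma>) (\<lambda>s. (v s)\<^sup>2) t"
    let ?b = "\<lambda>\<gamma>. \<omega> r \<gamma> * (t powr (1 - \<theta> r \<gamma>) / Gamma (2 - \<theta> r \<gamma>))"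
    have "(LINT \<gamma>:{\<alpha>..\<beta>}|lebesgue. \<omega> r \<gamma> * (LINT s:{0..t}|lebesgue. C r s \<gamma>))
        = (LINT \<gamma>:{\<alpha>..\<beta>}|lebesgue. ?a \<gamma> - (v 0)\<^sup>2 * ?b \<gamma>)"
    proof (rule set_lebesgue_integral_cong)
      show "\<forall>\<gamma>. \<gamma> \<in> {\<alpha>..\<beta>} \<longrightarrow> \<omega> r \<gamma> * (LINT s:{0..t}|lebesgue. C r s \<gamma>) = ?a \<gamma> - (v 0)\<^sup>2 * ?b \<gamma>"
        by (intro allI impI) (simp only: int_c[OF r] right_diff_distrib mult.left_commute)
    qed simp
    also have "\<dots> = (LINT \<gamma>:{\<alpha>..\<beta>}|lebesgue. ?a \<gamma>) - (LINT \<gamma>:{\<alpha>..\<beta>}|lebesgue. (v 0)\<^sup>2 * ?b \<gamma>)"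
      by (intro set_integral_diff(2) set_integrable_mult_right absolutely_integrable_continuous_mult \<omega> r rl2 wt)
    finally show "(LINT \<gamma>:{\<alpha>..\<beta>}|lebesgue. \<omega> r \<gamma> * (LINT s:{0..t}|lebesgue. C r s \<gamma>))
        = (LINT \<gamma>:{\<alpha>..\<beta>}|lebesgue. ?a \<gamma>) - (v 0)\<^sup>2 * (LINT \<gamma>:{\<alpha>..\<beta>}|lebesgue. ?b \<gamma>)"
      by (simp only: set_integral_mult_right)
  qed
  also have "\<dots> = (LINT \<gamma>:{\<alpha>..\<beta>}|lebesgue. \<Sum>r=1..m. \<omega> r \<gamma> * rl_integral (1 - \<theta> r \<gamma>) (\<lambda>s. (v s)\<^sup>2) t)
     - (v 0)\<^sup>2 * (LINT \<gamma>:{\<alpha>..\<beta>}|lebesgue. \<Sum>r=1..m. \<omega> r \<gamma> * (t powr (1 - \<theta> r \<gamma>) / Gamma (2 - \<theta> r \<gamma>)))"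
  proof -
    have "(LINT \<gamma>:{\<alpha>..\<beta>}|lebesgue. \<Sum>r=1..m. \<omega> r \<gamma> * rl_integral (1 - \<theta> r \<gamma>) (\<lambda>s. (v s)\<^sup>2) t)
      = (\<Sum>r=1..m. LINT \<gamma>:{\<alpha>..\<beta>}|lebesgue. \<omega> r \<gamma> * rl_integral (1 - \<theta> r \<gamma>) (\<lambda>s. (v s)\<^sup>2) t)"
      by (intro set_integral_finite_sum(2) absolutely_integrable_continuous_mult \<omega> rl2)
    moreover have "(LINT \<gamma>:{\<alpha>..\<beta>}|lebesgue. \<Sum>r=1..m. \<omega> r \<gamma> * (t powr (1 - \<theta> r \<gamma>) / Gamma (2 - \<theta> r \<gamma>)))
      = (\<Sum>r=1..m. LINT \<gamma>:{\<alpha>..\<beta>}|lebesgue. \<omega> r \<gamma> * (t powr (1 - \<theta> r \<gamma>) / Gamma (2 - \<theta> r \<gamma>)))"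
      by (intro set_integral_finite_sum(2) absolutely_integrable_continuous_mult \<omega> wt)
    ultimately show ?thesis by (simp only: sum_subtractf sum_distrib_left)
  qed
  finally have "(LINT s:{0..t}|lebesgue. c s) = \<dots>" .
  moreover have "(LINT s:{0..t}|lebesgue. c s) \<le> (LINT s:{0..t}|lebesgue. g s)"
    using g_int c_le unfolding c_def by (intro set_integral_mono set_integral_finite_sum(1) swap(1)) auto
  ultimately show ?thesis by (simp only: g_G times_divide_eq_right)
qed

section \<open>The energy in space\<close>

text \<open>The Cauchy-Schwarz inequality for \<open>U'\<close> against the constant 1, obtained by
  expanding the integral of \<open>(U' x - c)\<^sup>2\<close> with \<open>c\<close> the mean
  slope.\<close>

lemma increment_square_le:
  fixes U U' :: "real \<Rightarrow> real"
  assumes ab: "a \<le> b"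
    and U: "\<And>x. x \<in> {a..b} \<Longrightarrow> (U has_real_derivative U' x) (at x within {a..b})"
    and U': "continuous_on {a..b} U'"
  shows "(U b - U a)\<^sup>2 \<le> (b - a) * integral {a..b} (\<lambda>x. (U' x)\<^sup>2)"
proof (cases "a = b")
  case False
  define c where "c = (U b - U a) / (b - a)"
  have i1: "(U' has_integral (U b - U a)) {a..b}"
    by (rule fundamental_theorem_of_calculus[OF ab])
      (use U in \<open>simp add: has_real_derivative_iff_has_vector_derivative\<close>)
  have i2: "((\<lambda>x. (U' x)\<^sup>2) has_integral integral {a..b} (\<lambda>x. (U' x)\<^sup>2)) {a..b}"
    by (intro integrable_integral integrable_continuous_real continuous_intros U')
  have i3: "((\<lambda>x. c\<^sup>2) has_integral (b - a) * c\<^sup>2) {a..b}"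
    using has_integral_const_real[of "c\<^sup>2" a b] ab by simp
  have "((\<lambda>x. (U' x)\<^sup>2 - 2 * c * U' x + c\<^sup>2) has_integral
      (integral {a..b} (\<lambda>x. (U' x)\<^sup>2) - 2 * c * (U b - U a) + (b - a) * c\<^sup>2)) {a..b}"
    by (intro has_integral_add has_integral_diff has_integral_mult_right i1 i2 i3)
  moreover have "(U' x)\<^sup>2 - 2 * c * U' x + c\<^sup>2 = (U' x - c)\<^sup>2" for x
    by (simp add: power2_eq_square algebra_simps)
  ultimately have "((\<lambda>x. (U' x - c)\<^sup>2) has_integral
      (integral {a..b} (\<lambda>x. (U' x)\<^sup>2) - 2 * c * (U b - U a) + (b - a) * c\<^sup>2)) {a..b}"
    by simp
  then have "0 \<le> integral {a..b} (\<lambda>x. (U' x)\<^sup>2) - 2 * c * (U b - U a) + (b - a) * c\<^sup>2"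
    by (rule has_integral_nonneg) simp
  moreover have "U b - U a = c * (b - a)" using False by (simp add: c_def)
  ultimately have "(b - a) * c\<^sup>2 \<le> integral {a..b} (\<lambda>x. (U' x)\<^sup>2)"
    by (simp add: power2_eq_square algebra_simps)
  then have "(b - a) * ((b - a) * c\<^sup>2) \<le> (b - a) * integral {a..b} (\<lambda>x. (U' x)\<^sup>2)"
    using ab by (intro mult_left_mono) auto
  also have "(b - a) * ((b - a) * c\<^sup>2) = (U b - U a)\<^sup>2"
    unfolding \<open>U b - U a = c * (b - a)\<close> by (simp add: power2_eq_square algebra_simps)
  finally show ?thesis .
qed simp

text \<open>\<open>U x\<close> is compared with both end values. The increments cost
  \<open>x\<close> times the energy on \<open>{0..x}\<close> and \<open>l - x\<close> times that on
  \<open>{x..l}\<close>; both lengths are at most \<open>l\<close> and the two energies add up to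
  the whole, so the constant is 1. Integration over \<open>x\<close> supplies the second factor
  \<open>l\<close>.\<close>

lemma boundary_poincare:
  fixes U U' :: "real \<Rightarrow> real"
  assumes l: "0 \<le> l"
    and U: "\<And>x. x \<in> {0..l} \<Longrightarrow> (U has_real_derivative U' x) (at x within {0..l})"
    and U': "continuous_on {0..l} U'"
  shows "integral {0..l} (\<lambda>x. (U x)\<^sup>2)
    \<le> l\<^sup>2 * integral {0..l} (\<lambda>x. (U' x)\<^sup>2) + l * ((U 0)\<^sup>2 + (U l)\<^sup>2)"
proof -
  let ?J = "\<lambda>a b. integral {a..b} (\<lambda>x. (U' x)\<^sup>2)"
  have Uc: "continuous_on {0..l} U" using U by (meson DERIV_continuous_on)
  have J: "(\<lambda>x. (U' x)\<^sup>2) integrable_on {0..l}"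
    by (intro integrable_continuous_real continuous_intros U')
  \<comment> \<open>For arbitrary limits the function may fail to be integrable; its gauge integral
    is then 0 by convention.\<close>
  have J0: "0 \<le> ?J a b" for a b
    by (cases "(\<lambda>x. (U' x)\<^sup>2) integrable_on {a..b}")
      (simp_all add: Henstock_Kurzweil_Integration.integral_nonneg not_integrable_integral)
  have "(U x)\<^sup>2 \<le> (U 0)\<^sup>2 + (U l)\<^sup>2 + l * ?J 0 l" if x: "x \<in> {0..l}" for x
  proof -
    have sub: "(U has_real_derivative U' y) (at y within {a..b})"
      if "y \<in> {a..b}" "{a..b} \<subseteq> {0..l}" for a b y
      by (rule DERIV_subset[OF U that(2)]) (use that in blast)
    have "(U x - U 0)\<^sup>2 \<le> (x - 0) * ?J 0 x"
      by (rule increment_square_le)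
        (use x in \<open>auto intro!: sub continuous_on_subset[OF U']\<close>)
    moreover have "(U l - U x)\<^sup>2 \<le> (l - x) * ?J x l"
      by (rule increment_square_le)
        (use x in \<open>auto intro!: sub continuous_on_subset[OF U']\<close>)
    moreover have "x * ?J 0 x \<le> l * ?J 0 x" "(l - x) * ?J x l \<le> l * ?J x l"
      by (rule mult_right_mono[OF _ J0]; use x in simp)+
    moreover have "?J 0 l = ?J 0 x + ?J x l"
      using Henstock_Kurzweil_Integration.integral_combine[OF _ _ J, of x] x by simp
    then have "l * ?J 0 l = l * ?J 0 x + l * ?J x l" by (simp add: distrib_left)
    \<comment> \<open>Each end contributes one half:
      \<open>(U x)\<^sup>2 / 2 \<le> a\<^sup>2 + (U x - a)\<^sup>2\<close> for
      \<open>a = U 0\<close> and \<open>a = U l\<close>, a rearrangement of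
      \<open>(U x - 2 * a)\<^sup>2 \<ge> 0\<close>.\<close>
    moreover have "(U x)\<^sup>2 \<le> (U 0)\<^sup>2 + (U l)\<^sup>2 + (U x - U 0)\<^sup>2 + (U l - U x)\<^sup>2"
      using zero_le_power2[of "U x - 2 * U 0"] zero_le_power2[of "U x - 2 * U l"]
      by (simp add: power2_eq_square algebra_simps)
    ultimately show ?thesis unfolding diff_zero by linarith
  qed
  then have "integral {0..l} (\<lambda>x. (U x)\<^sup>2) \<le> integral {0..l} (\<lambda>x. (U 0)\<^sup>2 + (U l)\<^sup>2 + l * ?J 0 l)"
    by (rule integral_le[rotated 2]) (auto intro!: integrable_continuous_real continuous_intros Uc)
  also have "\<dots> = l * ((U 0)\<^sup>2 + (U l)\<^sup>2 + l * ?J 0 l)" using l by simp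
  finally show ?thesis by (simp add: power2_eq_square algebra_simps)
qed

text \<open>The balance, with \<open>A\<close>, \<open>B\<close>, \<open>V\<close> as defined in the
  proof: integration by parts and the Robin conditions give the dissipation
  \<open>- 2 * \<gamma> * (A + B)\<close>; Young's inequality for the terms with \<open>f\<close>,
  \<open>m1\<close>, \<open>m2\<close> spends \<open>\<gamma> / \<delta> * (V + B)\<close>, which
  the Poincare bound limits to \<open>\<gamma> * (A + B)\<close>. Half of the dissipation
  survives.\<close>

lemma robin_energy_inequality:
  fixes U U' D \<kappa> q f :: "real \<Rightarrow> real"
  assumes l: "0 < l" and c1: "0 < c1" and \<beta>0: "0 < \<beta>0"
    and U: "\<And>x. x \<in> {0..l} \<Longrightarrow> (U has_real_derivative U' x) (at x within {0..l})"
    and U': "continuous_on {0..l} U'"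
    and flux: "\<And>x. x \<in> {0..l} \<Longrightarrow> ((\<lambda>x. \<kappa> x * U' x) has_real_derivative D x) (at x within {0..l})"
    and D: "continuous_on {0..l} D" and \<kappa>: "continuous_on {0..l} \<kappa>"
    and q: "continuous_on {0..l} q" and f: "continuous_on {0..l} f"
    and \<kappa>_lower: "\<And>x. x \<in> {0..l} \<Longrightarrow> c1 \<le> \<kappa> x"
    and q_nonneg: "\<And>x. x \<in> {0..l} \<Longrightarrow> 0 \<le> q x"
    and b: "\<beta>0 \<le> b1" "\<beta>0 \<le> b2"
    and left: "\<kappa> 0 * U' 0 = b1 * U 0 - m1" and right: "- (\<kappa> l * U' l) = b2 * U l - m2"
    and \<gamma>: "\<gamma> = min c1 \<beta>0" and \<delta>: "\<delta> = max (1 + l) (l\<^sup>2)"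
  shows "integral {0..l} (\<lambda>x. 2 * U x * (D x - q x * U x + f x))
      + \<gamma> * (integral {0..l} (\<lambda>x. (U' x)\<^sup>2) + (U 0)\<^sup>2 + (U l)\<^sup>2)
    \<le> \<delta> / \<gamma> * (integral {0..l} (\<lambda>x. (f x)\<^sup>2) + m1\<^sup>2 + m2\<^sup>2)"
proof -
  have Uc: "continuous_on {0..l} U" using U by (meson DERIV_continuous_on)
  have \<gamma>0: "0 < \<gamma>" and \<delta>0: "0 < \<delta>" using \<gamma> \<delta> c1 \<beta>0 l by auto
  define A where "A = integral {0..l} (\<lambda>x. (U' x)\<^sup>2)"
  define B where "B = (U 0)\<^sup>2 + (U l)\<^sup>2"
  define V where "V = integral {0..l} (\<lambda>x. (U x)\<^sup>2)"
  define N where "N = integral {0..l} (\<lambda>x. (f x)\<^sup>2)"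
  have A0: "0 \<le> A" unfolding A_def
    by (intro integral_nonneg integrable_continuous_real continuous_intros U') auto
  have B0: "0 \<le> B" by (simp add: B_def)
  have iA: "((\<lambda>x. (U' x)\<^sup>2) has_integral A) {0..l}" and iV: "((\<lambda>x. (U x)\<^sup>2) has_integral V) {0..l}"
    and iN: "((\<lambda>x. (f x)\<^sup>2) has_integral N) {0..l}"
    unfolding A_def V_def N_def
    by (intro integrable_integral integrable_continuous_real continuous_intros U' Uc f)+
  have parts: "((\<lambda>x. U' x * (\<kappa> x * U' x) + U x * D x) has_integral
      (U l * (\<kappa> l * U' l) - U 0 * (\<kappa> 0 * U' 0))) {0..l}"
  proof (rule fundamental_theorem_of_calculus)
    fix x assume x: "x \<in> {0..l}"
    have "((\<lambda>x. U x * (\<kappa> x * U' x)) has_real_derivative U' x * (\<kappa> x * U' x) + D x * U x) (at x within {0..l})"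
      by (rule DERIV_mult[OF U[OF x] flux[OF x]])
    then show "((\<lambda>x. U x * (\<kappa> x * U' x)) has_vector_derivative U' x * (\<kappa> x * U' x) + U x * D x) (at x within {0..l})"
      by (simp add: has_real_derivative_iff_has_vector_derivative mult.commute)
  qed (use l in simp)
  have young: "2 * (a * b) \<le> \<delta> / \<gamma> * a\<^sup>2 + \<gamma> / \<delta> * b\<^sup>2" for a b :: real
  proof -
    have "0 \<le> (\<delta> * a - \<gamma> * b)\<^sup>2 / (\<gamma> * \<delta>)" using \<gamma>0 \<delta>0 by simp
    also have "\<dots> = \<delta> / \<gamma> * a\<^sup>2 + \<gamma> / \<delta> * b\<^sup>2 - 2 * (a * b)"
      using \<gamma>0 \<delta>0 by (simp add: field_simps power2_eq_square)
    finally show ?thesis by simp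
  qed
  \<comment> \<open>\<open>U' x * (\<kappa> x * U' x) + U x * D x\<close> is the derivative of
    \<open>U * (\<kappa> * U')\<close>. The subtracted energy uses
    \<open>\<gamma> \<le> c1 \<le> \<kappa> x\<close>, and the \<open>q\<close> term is dropped by
    its sign.\<close>
  have pointwise: "2 * U x * (D x - q x * U x + f x)
      \<le> 2 * (U' x * (\<kappa> x * U' x) + U x * D x) - 2 * \<gamma> * (U' x)\<^sup>2 + (\<delta> / \<gamma> * (f x)\<^sup>2 + \<gamma> / \<delta> * (U x)\<^sup>2)"
    if x: "x \<in> {0..l}" for x
  proof -
    have "\<gamma> * (U' x)\<^sup>2 \<le> \<kappa> x * (U' x)\<^sup>2"
      using \<kappa>_lower[OF x] \<gamma> by (intro mult_right_mono) auto
    moreover have "0 \<le> q x * (U x)\<^sup>2" using q_nonneg[OF x] by simp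
    moreover note young[of "f x" "U x"]
    ultimately show ?thesis by (simp add: power2_eq_square algebra_simps)
  qed
  have "integral {0..l} (\<lambda>x. 2 * U x * (D x - q x * U x + f x))
      \<le> 2 * (U l * (\<kappa> l * U' l) - U 0 * (\<kappa> 0 * U' 0)) - 2 * \<gamma> * A + (\<delta> / \<gamma> * N + \<gamma> / \<delta> * V)"
  proof (rule has_integral_le[OF integrable_integral _ pointwise])
    show "(\<lambda>x. 2 * U x * (D x - q x * U x + f x)) integrable_on {0..l}"
      by (intro integrable_continuous_real continuous_intros Uc D q f)
    show "((\<lambda>x. 2 * (U' x * (\<kappa> x * U' x) + U x * D x) - 2 * \<gamma> * (U' x)\<^sup>2 + (\<delta> / \<gamma> * (f x)\<^sup>2 + \<gamma> / \<delta> * (U x)\<^sup>2))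
      has_integral 2 * (U l * (\<kappa> l * U' l) - U 0 * (\<kappa> 0 * U' 0)) - 2 * \<gamma> * A + (\<delta> / \<gamma> * N + \<gamma> / \<delta> * V)) {0..l}"
      by (intro has_integral_add has_integral_diff has_integral_mult_right parts iA iN iV)
  qed
  also have "2 * (U l * (\<kappa> l * U' l) - U 0 * (\<kappa> 0 * U' 0))
      \<le> \<delta> / \<gamma> * (m1\<^sup>2 + m2\<^sup>2) + \<gamma> / \<delta> * B - 2 * \<gamma> * B"
  proof -
    have r: "\<kappa> l * U' l = m2 - b2 * U l" using right by simp
    have "\<gamma> * (U 0)\<^sup>2 \<le> b1 * (U 0)\<^sup>2" "\<gamma> * (U l)\<^sup>2 \<le> b2 * (U l)\<^sup>2"
      using b \<gamma> by (auto intro!: mult_right_mono)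
    with young[of m1 "U 0"] young[of m2 "U l"] show ?thesis
      unfolding left r B_def by (simp add: power2_eq_square algebra_simps)
  qed
  also have "\<gamma> / \<delta> * V \<le> \<gamma> * A + \<gamma> * B - \<gamma> / \<delta> * B"
  proof -
    \<comment> \<open>The origin of \<open>\<delta>\<close>: \<open>l\<^sup>2\<close> is the
      constant of the Poincare bound, and \<open>1 + l\<close> adds the \<open>B\<close> spent on
      \<open>m1\<close> and \<open>m2\<close> to the boundary part \<open>l * B\<close> of that
      bound.\<close>
    have "V + B \<le> l\<^sup>2 * A + (1 + l) * B"
      using boundary_poincare[OF _ U U'] l by (simp add: V_def A_def B_def algebra_simps)
    also have "\<dots> \<le> \<delta> * A + \<delta> * B"
      using A0 B0 \<delta> by (intro add_mono mult_right_mono) auto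
    finally have "\<gamma> / \<delta> * (V + B) \<le> \<gamma> / \<delta> * (\<delta> * A + \<delta> * B)"
      using \<gamma>0 \<delta>0 by (intro mult_left_mono) auto
    also have "\<dots> = \<gamma> * A + \<gamma> * B" using \<delta>0 by (simp add: field_simps)
    finally show ?thesis by (simp only: distrib_left)
  qed
  finally show ?thesis
    unfolding A_def[symmetric] N_def[symmetric] using B_def by (simp add: algebra_simps)
qed

section \<open>The a priori estimate\<close>

text \<open>Makes the integrals over \<open>x\<close> of the fractional energy and of the initial
  weight genuine, so that they can be subtracted and compared. Integrability of each slice splits
  the sum at every \<open>x\<close>; integrability over the rectangle then gives integrability in
  \<open>x\<close>.\<close>

lemma distributed_weight_integrable:
  fixes \<omega> R :: "nat \<Rightarrow> real \<Rightarrow> real \<Rightarrow> real"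
  assumes \<omega>: "\<And>r. r \<in> {1..m} \<Longrightarrow> set_integrable lebesgue ({0..l} \<times> {\<alpha>..\<beta>}) (\<lambda>(x, \<gamma>). \<omega> r x \<gamma>)"
    and slice: "\<And>r x. r \<in> {1..m} \<Longrightarrow> x \<in> {0..l} \<Longrightarrow> set_integrable lebesgue {\<alpha>..\<beta>} (\<lambda>\<gamma>. \<omega> r x \<gamma>)"
    and R: "\<And>r. r \<in> {1..m} \<Longrightarrow> continuous_on ({0..l} \<times> {\<alpha>..\<beta>}) (\<lambda>(x, \<gamma>). R r x \<gamma>)"
  shows "(\<lambda>x. LINT \<gamma>:{\<alpha>..\<beta>}|lebesgue. \<Sum>r=1..m. \<omega> r x \<gamma> * R r x \<gamma>) absolutely_integrable_on {0..l}"
proof -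
  have "continuous_on {\<alpha>..\<beta>} (R r x)" if "r \<in> {1..m}" "x \<in> {0..l}" for r x
    using continuous_on_compose2[OF R[OF that(1)], of "{\<alpha>..\<beta>}" "\<lambda>\<gamma>. (x, \<gamma>)"] that(2)
    by (force intro: continuous_intros)
  then have eq: "(LINT \<gamma>:{\<alpha>..\<beta>}|lebesgue. \<Sum>r=1..m. \<omega> r x \<gamma> * R r x \<gamma>)
      = (\<Sum>r=1..m. LINT \<gamma>:{\<alpha>..\<beta>}|lebesgue. \<omega> r x \<gamma> * R r x \<gamma>)" if "x \<in> {0..l}" for x
    using that by (intro set_integral_finite_sum(2) absolutely_integrable_continuous_mult slice)
  have "(\<lambda>x. \<Sum>r=1..m. LINT \<gamma>:{\<alpha>..\<beta>}|lebesgue. \<omega> r x \<gamma> * R r x \<gamma>) absolutely_integrable_on {0..l}"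
    by (intro set_integral_finite_sum(1) set_integral_weighted_slice \<omega> R)
  then show ?thesis
    by (rule absolutely_integrable_spike_finite(1)[where F="{}"]) (use eq in auto)
qed

section \<open>Derivatives, slices and continuity on the closed rectangle\<close>

lemma Dx_has_real_derivative:
  assumes "(\<lambda>y. u y t) differentiable (at x within {0..l})"
  shows "((\<lambda>y. u y t) has_real_derivative Dx l u x t) (at x within {0..l})"
  using assms unfolding Dx_def has_real_derivative_iff_has_vector_derivative
  by (simp add: vector_derivative_works)

lemma Dt_has_real_derivative:
  assumes "(\<lambda>s. u x s) differentiable (at t within {0..T})"
  shows "((\<lambda>s. u x s) has_real_derivative Dt T u x t) (at t within {0..T})"
  using assms unfolding Dt_def has_real_derivative_iff_has_vector_derivative
  by (simp add: vector_derivative_works)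

lemma Dx_eqI:
  assumes "((\<lambda>y. u y t) has_real_derivative D) (at x within {0..l})" "0 < l" "x \<in> {0..l}"
  shows "Dx l u x t = D"
  using assms unfolding Dx_def has_real_derivative_iff_has_vector_derivative
  by (intro vector_derivative_within_closed_interval)

lemma continuous_on_rect_slices:
  fixes g :: "real \<Rightarrow> real \<Rightarrow> real"
  assumes "continuous_on (rect l T) (\<lambda>(x, t). g x t)"
  shows "t \<in> {0..T} \<Longrightarrow> continuous_on {0..l} (\<lambda>x. g x t)"
    and "x \<in> {0..l} \<Longrightarrow> continuous_on {0..T} (\<lambda>t. g x t)"
    and "continuous_on {0..T} (\<lambda>t. integral {0..l} (\<lambda>x. g x t))"
proof -
  show "continuous_on {0..l} (\<lambda>x. g x t)" if "t \<in> {0..T}"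
    using continuous_on_compose2[OF assms, of "{0..l}" "\<lambda>x. (x, t)"] that
    by (force intro: continuous_intros)
  show "continuous_on {0..T} (\<lambda>t. g x t)" if "x \<in> {0..l}"
    using continuous_on_compose2[OF assms, of "{0..T}" "\<lambda>t. (x, t)"] that
    by (force intro: continuous_intros)
  have "continuous_on ({0..T} \<times> cbox 0 l) (\<lambda>p. (\<lambda>(x, t). g x t) (snd p, fst p))"
    by (rule continuous_on_compose2[OF assms]) (auto intro!: continuous_intros)
  then have "continuous_on ({0..T} \<times> cbox 0 l) (\<lambda>(t, x). g x t)"
    by (simp add: case_prod_beta)
  from integral_continuous_on_param[OF this]
  show "continuous_on {0..T} (\<lambda>t. integral {0..l} (\<lambda>x. g x t))" by simp
qed

lemma continuous_on_case_prod_intros: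
  fixes f g :: "real \<Rightarrow> real \<Rightarrow> real"
  assumes "continuous_on S (\<lambda>(x, t). f x t)" "continuous_on S (\<lambda>(x, t). g x t)"
  shows "continuous_on S (\<lambda>(x, t). f x t + g x t)"
    and "continuous_on S (\<lambda>(x, t). f x t - g x t)"
    and "continuous_on S (\<lambda>(x, t). f x t * g x t)"
  using assms unfolding case_prod_beta by (intro continuous_intros; simp)+

theorem theorem2:
  fixes l T \<alpha> \<beta> c1 c2 \<beta>0 \<gamma>1 \<delta>1 :: real
    and m :: nat
    and \<theta> \<omega> :: "nat \<Rightarrow> real \<Rightarrow> real \<Rightarrow> real"
    and k q f u :: "real \<Rightarrow> real \<Rightarrow> real"
    and \<beta>1 \<beta>2 \<mu>1 \<mu>2 u0 :: "real \<Rightarrow> real"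
  assumes "0 < l" and "0 < T" and "\<alpha> < \<beta>" and "1 \<le> m"
    and theta_cont: "\<And>r. r \<in> {1..m} \<Longrightarrow> continuous_on ({0..l} \<times> {\<alpha>..\<beta>}) (\<lambda>(x, \<gamma>). \<theta> r x \<gamma>)"
    and theta_range: "\<And>r x \<gamma>. r \<in> {1..m} \<Longrightarrow> x \<in> {0..l} \<Longrightarrow> \<gamma> \<in> {\<alpha>..\<beta>} \<Longrightarrow>
          0 < \<theta> r x \<gamma> \<and> \<theta> r x \<gamma> < 1"
    and omega_nonneg: "\<And>r x \<gamma>. r \<in> {1..m} \<Longrightarrow> x \<in> {0..l} \<Longrightarrow> \<gamma> \<in> {\<alpha>..\<beta>} \<Longrightarrow> 0 \<le> \<omega> r x \<gamma>"
    and omega_integrable: "\<And>r. r \<in> {1..m} \<Longrightarrow>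
          set_integrable lebesgue ({0..l} \<times> {\<alpha>..\<beta>}) (\<lambda>(x, \<gamma>). \<omega> r x \<gamma>)"
    and omega_slice_integrable: "\<And>r x. r \<in> {1..m} \<Longrightarrow> x \<in> {0..l} \<Longrightarrow>
          set_integrable lebesgue {\<alpha>..\<beta>} (\<lambda>\<gamma>. \<omega> r x \<gamma>)"
    and omega_pos: "\<And>x. x \<in> {0..l} \<Longrightarrow> 0 < (LINT \<gamma>:{\<alpha>..\<beta>}|lebesgue. \<Sum>r=1..m. \<omega> r x \<gamma>)"
    and k_class: "C_class l T 1 0 k"
    and k_upper: "\<And>x t. x \<in> {0..l} \<Longrightarrow> t \<in> {0..T} \<Longrightarrow> k x t \<le> c2"
    and q_cont: "continuous_on (rect l T) (\<lambda>(x, t). q x t)"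
    and f_cont: "continuous_on (rect l T) (\<lambda>(x, t). f x t)"
    and "0 < c1"
    and k_lower: "\<And>x t. x \<in> {0..l} \<Longrightarrow> t \<in> {0..T} \<Longrightarrow> c1 \<le> k x t"
    and q_nonneg: "\<And>x t. x \<in> {0..l} \<Longrightarrow> t \<in> {0..T} \<Longrightarrow> 0 \<le> q x t"
    and "continuous_on {0..T} \<beta>1" and "continuous_on {0..T} \<beta>2"
    and "continuous_on {0..T} \<mu>1" and "continuous_on {0..T} \<mu>2"
    and "0 < \<beta>0"
    and beta_lower: "\<And>t. t \<in> {0..T} \<Longrightarrow> \<beta>0 \<le> \<beta>1 t \<and> \<beta>0 \<le> \<beta>2 t"
    and u_class: "C_class l T 2 1 u"
    and equation: "\<And>x t. x \<in> {0<..<l} \<Longrightarrow> t \<in> {0<..T} \<Longrightarrow>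
          P_caputo \<alpha> \<beta> m \<theta> \<omega> u x t =
            Dx l (\<lambda>y s. k y s * Dx l u y s) x t - q x t * u x t + f x t"
    and bc_left: "\<And>t. t \<in> {0..T} \<Longrightarrow> k 0 t * Dx l u 0 t = \<beta>1 t * u 0 t - \<mu>1 t"
    and bc_right: "\<And>t. t \<in> {0..T} \<Longrightarrow> - (k l t * Dx l u l t) = \<beta>2 t * u l t - \<mu>2 t"
    and initial: "\<And>x. x \<in> {0..l} \<Longrightarrow> u x 0 = u0 x"
    and gamma1: "\<gamma>1 = min c1 \<beta>0"
    and delta1: "\<delta>1 = max (1 + l) (l\<^sup>2)"
  shows "\<forall>t\<in>{0<..T}.
      (LINT x:{0..l}|lebesgue. P_rl \<alpha> \<beta> m \<theta> \<omega> (\<lambda>y s. (u y s)\<^sup>2) x t)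
      + \<gamma>1 * (LINT s:{0..t}|lebesgue. norm0_sq l (Dx l u) s + (u 0 s)\<^sup>2 + (u l s)\<^sup>2)
      \<le> \<delta>1 / \<gamma>1 * (LINT s:{0..t}|lebesgue. norm0_sq l f s + (\<mu>1 s)\<^sup>2 + (\<mu>2 s)\<^sup>2)
        + (LINT x:{0..l}|lebesgue. (u0 x)\<^sup>2 *
             (LINT \<gamma>:{\<alpha>..\<beta>}|lebesgue.
                \<Sum>r=1..m. \<omega> r x \<gamma> * t powr (1 - \<theta> r x \<gamma>) / Gamma (2 - \<theta> r x \<gamma>)))"
proof
  fix t assume t: "t \<in> {0<..T}"
  have \<gamma>1_pos: "0 < \<gamma>1" using gamma1 \<open>0 < c1\<close> \<open>0 < \<beta>0\<close> by simp

  \<comment> \<open>Regularity of the solution and of the right-hand side\<close>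
  have u_x: "((\<lambda>y. u y s) has_real_derivative Dx l u x s) (at x within {0..l})"
    and u_xx: "((\<lambda>y. Dx l u y s) has_real_derivative Dx l (Dx l u) x s) (at x within {0..l})"
    and u_t: "((\<lambda>s. u x s) has_real_derivative Dt T u x s) (at s within {0..T})"
    and k_x: "((\<lambda>y. k y s) has_real_derivative Dx l k x s) (at x within {0..l})"
    if "x \<in> {0..l}" "s \<in> {0..T}" for x s
    using u_class k_class that unfolding C_class_def numeral_2_eq_2
    by (auto intro!: Dx_has_real_derivative Dt_has_real_derivative simp: less_Suc_eq)
  have u_cont: "continuous_on (rect l T) (\<lambda>(x, s). u x s)"
    and ux_cont: "continuous_on (rect l T) (\<lambda>(x, s). Dx l u x s)"
    and uxx_cont: "continuous_on (rect l T) (\<lambda>(x, s). Dx l (Dx l u) x s)"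
    and ut_cont: "continuous_on (rect l T) (\<lambda>(x, s). Dt T u x s)"
    and k_cont: "continuous_on (rect l T) (\<lambda>(x, s). k x s)"
    and kx_cont: "continuous_on (rect l T) (\<lambda>(x, s). Dx l k x s)"
    using u_class k_class unfolding C_class_def numeral_2_eq_2 by (auto simp: le_Suc_eq all_conj_distrib)
  \<comment> \<open>\<open>D\<close> is the derivative of the flux expanded by the product rule, and
    \<open>G\<close> is the right-hand side built from it. Both are continuous on the closed
    rectangle, while the equation identifies \<open>G\<close> with \<open>P_caputo\<close> only for
    \<open>0 < x < l\<close> and positive time.\<close>
  define D where "D x s = Dx l k x s * Dx l u x s + k x s * Dx l (Dx l u) x s" for x s
  define G where "G x s = D x s - q x s * u x s + f x s" for x s
  \<comment> \<open>This is \<open>2 * u * G\<close>, written with a sum so that only sums,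
    differences and products of continuous functions occur.\<close>
  define H where "H x s = (u x s + u x s) * G x s" for x s
  have flux: "((\<lambda>y. k y s * Dx l u y s) has_real_derivative D x s) (at x within {0..l})"
    if "x \<in> {0..l}" "s \<in> {0..T}" for x s
    using DERIV_mult[OF k_x[OF that] u_xx[OF that]] by (simp add: D_def add.commute mult.commute)
  have D_cont: "continuous_on (rect l T) (\<lambda>(x, s). D x s)"
    and G_cont: "continuous_on (rect l T) (\<lambda>(x, s). G x s)"
    and H_cont: "continuous_on (rect l T) (\<lambda>(x, s). H x s)"
    unfolding H_def G_def D_def
    by (intro continuous_on_case_prod_intros u_cont ux_cont uxx_cont k_cont kx_cont q_cont f_cont)+
  have H_eq: "H x = (\<lambda>s. 2 * u x s * G x s)" for x by (simp add: H_def fun_eq_iff)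
  have eqG: "P_caputo \<alpha> \<beta> m \<theta> \<omega> u x s = G x s" if "x \<in> {0<..<l}" "s \<in> {0<..T}" for x s
  proof -
    have "Dx l (\<lambda>y s. k y s * Dx l u y s) x s = D x s"
      by (rule Dx_eqI) (use flux that \<open>0 < l\<close> in auto)
    then show ?thesis using equation[OF that] by (simp add: G_def)
  qed

  \<comment> \<open>The time inequality at a fixed interior point\<close>
  let ?P = "\<lambda>x. P_rl \<alpha> \<beta> m \<theta> \<omega> (\<lambda>y s. (u y s)\<^sup>2) x t"
  let ?W = "\<lambda>x. LINT \<gamma>:{\<alpha>..\<beta>}|lebesgue. \<Sum>r=1..m. \<omega> r x \<gamma> * t powr (1 - \<theta> r x \<gamma>) / Gamma (2 - \<theta> r x \<gamma>)"
  let ?A = "\<lambda>x. integral {0..t} (H x)"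
  have pointwise: "?P x - (u0 x)\<^sup>2 * ?W x \<le> ?A x" if x: "x \<in> {0<..<l}" for x
  proof -
    have x': "x \<in> {0..l}" using x by simp
    have "?P x - (u x 0)\<^sup>2 * ?W x \<le> integral {0..t} (\<lambda>s. 2 * u x s * G x s)"
      unfolding P_rl_def
    proof (rule distributed_energy_time_inequality[where v'="Dt T u x"])
      show "0 < t" using t by simp
      show "((\<lambda>s. u x s) has_real_derivative Dt T u x s) (at s within {0..t})" if "s \<in> {0..t}" for s
        by (rule DERIV_subset[OF u_t]) (use that t x' in auto)
      show "continuous_on {0..t} (Dt T u x)" "continuous_on {0..t} (G x)"
        using continuous_on_rect_slices(2)[OF ut_cont x'] continuous_on_rect_slices(2)[OF G_cont x'] t
        by (auto elim!: continuous_on_subset)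
      show "continuous_on {\<alpha>..\<beta>} (\<theta> r x)" if "r \<in> {1..m}" for r
        using continuous_on_compose2[OF theta_cont[OF that], of "{\<alpha>..\<beta>}" "\<lambda>\<gamma>. (x, \<gamma>)"] x'
        by (force intro: continuous_intros)
      show "(LINT \<gamma>:{\<alpha>..\<beta>}|lebesgue. \<Sum>r=1..m. \<omega> r x \<gamma> * caputo (\<theta> r x \<gamma>) (\<lambda>s. u x s) s) = G x s"
        if "s \<in> {0<..t}" for s
        using eqG[OF x, of s] that t by (simp add: P_caputo_def)
    qed (use theta_range omega_nonneg omega_slice_integrable x' in auto)
    then show ?thesis using initial[OF x'] by (simp add: H_eq)
  qed

  \<comment> \<open>Integrability in \<open>x\<close> of the fractional energy and the initial
    term\<close>
  have rl_cont: "continuous_on ({0..l} \<times> {\<alpha>..\<beta>}) (\<lambda>(x, \<gamma>). rl_integral (1 - \<theta> r x \<gamma>) (\<lambda>s. (u x s)\<^sup>2) t)"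
    and wt_cont: "continuous_on ({0..l} \<times> {\<alpha>..\<beta>}) (\<lambda>(x, \<gamma>). t powr (1 - \<theta> r x \<gamma>) / Gamma (2 - \<theta> r x \<gamma>))"
    if r: "r \<in> {1..m}" for r
  proof -
    have \<theta>c: "continuous_on ({0..l} \<times> {\<alpha>..\<beta>}) (\<lambda>p. \<theta> r (fst p) (snd p))"
      using theta_cont[OF r] by (simp add: case_prod_beta)
    \<comment> \<open>The time \<open>t\<close> is frozen and the parameter is the pair
      \<open>p = (x, \<gamma>)\<close>: it determines the order, and its first component selects the
      function to be integrated.\<close>
    have "continuous_on (({0..l} \<times> {\<alpha>..\<beta>}) \<times> {0..T}) (\<lambda>z. ((\<lambda>(x, s). u x s) (fst (fst z), snd z))\<^sup>2)"
      by (intro continuous_on_power continuous_on_compose2[OF u_cont] continuous_intros) auto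
    then have uc: "continuous_on (({0..l} \<times> {\<alpha>..\<beta>}) \<times> {0..T}) (\<lambda>(p, s). (u (fst p) s)\<^sup>2)"
      by (simp add: case_prod_beta)
    have "continuous_on ({0..l} \<times> {\<alpha>..\<beta>}) (\<lambda>p. rl_integral (1 - \<theta> r (fst p) (snd p)) (\<lambda>s. (u (fst p) s)\<^sup>2) t)"
      by (rule continuous_on_rl_integral[OF _ _ _ _ _ uc])
        (use t theta_range[OF r] in \<open>auto intro!: compact_Times continuous_intros \<theta>c\<close>)
    then show "continuous_on ({0..l} \<times> {\<alpha>..\<beta>}) (\<lambda>(x, \<gamma>). rl_integral (1 - \<theta> r x \<gamma>) (\<lambda>s. (u x s)\<^sup>2) t)"
      by (simp add: case_prod_beta)
    have pos: "0 < 2 - \<theta> r (fst p) (snd p)" if "p \<in> {0..l} \<times> {\<alpha>..\<beta>}" for p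
      using theta_range[OF r, of "fst p" "snd p"] that by auto
    have "continuous_on ({0..l} \<times> {\<alpha>..\<beta>}) (\<lambda>p. Gamma (2 - \<theta> r (fst p) (snd p)))"
      by (rule continuous_on_compose2[OF continuous_on_Gamma, of "{0<..}"])
        (use pos in \<open>auto dest: nonpos_Ints_nonpos intro!: continuous_intros \<theta>c\<close>)
    then have "continuous_on ({0..l} \<times> {\<alpha>..\<beta>}) (\<lambda>p. t powr (1 - \<theta> r (fst p) (snd p)) / Gamma (2 - \<theta> r (fst p) (snd p)))"
      using Gamma_real_pos[OF pos] t by (intro continuous_intros \<theta>c) fastforce+
    then show "continuous_on ({0..l} \<times> {\<alpha>..\<beta>}) (\<lambda>(x, \<gamma>). t powr (1 - \<theta> r x \<gamma>) / Gamma (2 - \<theta> r x \<gamma>))"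
      by (simp add: case_prod_beta)
  qed
  have P_int: "?P absolutely_integrable_on {0..l}"
    unfolding P_rl_def
    by (rule distributed_weight_integrable[OF omega_integrable omega_slice_integrable rl_cont])
  have "?W absolutely_integrable_on {0..l}"
    unfolding times_divide_eq_right[symmetric]
    by (rule distributed_weight_integrable[OF omega_integrable omega_slice_integrable wt_cont])
  moreover have "continuous_on {0..l} (\<lambda>x. (u0 x)\<^sup>2)"
  proof -
    have "continuous_on {0..l} (\<lambda>x. (u x 0)\<^sup>2)"
      by (intro continuous_on_power continuous_on_rect_slices(1)[OF u_cont]) (use \<open>0 < T\<close> in simp)
    then show ?thesis by (rule continuous_on_eq) (simp add: initial)
  qed
  ultimately have W_int: "(\<lambda>x. (u0 x)\<^sup>2 * ?W x) absolutely_integrable_on {0..l}"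
    using absolutely_integrable_continuous_mult[of 0 l "\<lambda>x. (u0 x)\<^sup>2" ?W] by (simp add: mult.commute)

  have H_cont_t: "continuous_on (cbox (0, 0) (l, t)) (\<lambda>(x, s). H x s)"
    by (rule continuous_on_subset[OF H_cont]) (use t in \<open>auto simp: cbox_Pair_eq\<close>)
  have A_cont: "continuous_on {0..l} ?A"
    using integral_continuous_on_param[of "{0..l}" 0 t H] H_cont_t by (simp add: cbox_Pair_eq)

  \<comment> \<open>The spatial norms as continuous functions of time\<close>
  define E where "E s = integral {0..l} (\<lambda>x. (Dx l u x s)\<^sup>2) + (u 0 s)\<^sup>2 + (u l s)\<^sup>2" for s
  define N where "N s = integral {0..l} (\<lambda>x. (f x s)\<^sup>2) + (\<mu>1 s)\<^sup>2 + (\<mu>2 s)\<^sup>2" for s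
  let ?d = "\<delta>1 / \<gamma>1"
  have norm_ux: "norm0_sq l (Dx l u) s = integral {0..l} (\<lambda>x. (Dx l u x s)\<^sup>2)"
    and norm_f: "norm0_sq l f s = integral {0..l} (\<lambda>x. (f x s)\<^sup>2)" if "s \<in> {0..T}" for s
    unfolding norm0_sq_def
    by (intro set_lebesgue_integral_continuous continuous_on_power that
        continuous_on_rect_slices(1)[OF ux_cont] continuous_on_rect_slices(1)[OF f_cont])+
  have sub: "continuous_on {0..T} g \<Longrightarrow> continuous_on {0..t} g" for g :: "real \<Rightarrow> real"
    using t by (auto elim: continuous_on_subset)
  have "continuous_on {0..T} (\<lambda>s. integral {0..l} (\<lambda>x. (Dx l u x s)\<^sup>2))"
    "continuous_on {0..T} (\<lambda>s. integral {0..l} (\<lambda>x. (f x s)\<^sup>2))"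
    unfolding power2_eq_square
    by (intro continuous_on_rect_slices(3) continuous_on_case_prod_intros ux_cont f_cont)+
  moreover have "continuous_on {0..T} (u 0)" "continuous_on {0..T} (u l)"
    using continuous_on_rect_slices(2)[OF u_cont] \<open>0 < l\<close> by auto
  ultimately have E_cont: "continuous_on {0..t} E" and N_cont: "continuous_on {0..t} N"
    unfolding E_def N_def using \<open>continuous_on {0..T} \<mu>1\<close> \<open>continuous_on {0..T} \<mu>2\<close>
    by (auto intro!: sub continuous_intros)
  have Hs_cont: "continuous_on {0..t} (\<lambda>s. integral {0..l} (\<lambda>x. H x s))"
    by (intro sub continuous_on_rect_slices(3) H_cont)

  \<comment> \<open>Integration over \<open>x\<close> and combination of both inequalities\<close>
  have "(LINT x:{0..l}|lebesgue. ?P x) - (LINT x:{0..l}|lebesgue. (u0 x)\<^sup>2 * ?W x)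
      = (LINT x:{0..l}|lebesgue. ?P x - (u0 x)\<^sup>2 * ?W x)"
    by (rule set_integral_diff(2)[OF P_int W_int, symmetric])
  also have "\<dots> \<le> integral {0..l} ?A"
  proof -
    define h where "h x = (if x \<in> {0<..<l} then ?P x - (u0 x)\<^sup>2 * ?W x else ?A x)" for x
    note spike = absolutely_integrable_spike_finite[OF set_integral_diff(1)[OF P_int W_int], of "{0, l}" h]
    have h: "h absolutely_integrable_on {0..l}"
      "(LINT x:{0..l}|lebesgue. h x) = (LINT x:{0..l}|lebesgue. ?P x - (u0 x)\<^sup>2 * ?W x)"
      by (intro spike; auto simp: h_def)+
    have "(LINT x:{0..l}|lebesgue. h x) \<le> (LINT x:{0..l}|lebesgue. ?A x)"
      using pointwise
      by (intro set_integral_mono h absolutely_integrable_continuous_real A_cont) (auto simp: h_def)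
    then show ?thesis by (simp only: h set_lebesgue_integral_continuous[OF A_cont])
  qed
  also have "\<dots> = integral {0..t} (\<lambda>s. integral {0..l} (\<lambda>x. H x s))"
    using integral_swap_continuous[OF H_cont_t] by simp
  also have "\<dots> \<le> integral {0..t} (\<lambda>s. ?d * N s - \<gamma>1 * E s)"
  proof (rule integral_le)
    show "(\<lambda>s. integral {0..l} (\<lambda>x. H x s)) integrable_on {0..t}"
      by (intro integrable_continuous_real) (rule Hs_cont)
    show "(\<lambda>s. ?d * N s - \<gamma>1 * E s) integrable_on {0..t}"
      by (intro integrable_continuous_real continuous_intros N_cont E_cont) (use \<gamma>1_pos in simp)
    fix s assume "s \<in> {0..t}"
    then have s: "s \<in> {0..T}" using t by simp
    \<comment> \<open>The spatial inequality rests on \<open>G\<close> and the boundary conditions,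
      both given on the closed time interval, so \<open>s = 0\<close> is included.\<close>
    have "integral {0..l} (\<lambda>x. 2 * u x s * (D x s - q x s * u x s + f x s)) + \<gamma>1 * E s \<le> ?d * N s"
      unfolding E_def N_def
      by (rule robin_energy_inequality[where \<kappa>="\<lambda>x. k x s" and ?b1.0="\<beta>1 s" and ?b2.0="\<beta>2 s" and ?c1.0=c1 and ?\<beta>0.0=\<beta>0])
        (use s u_x flux k_lower q_nonneg beta_lower bc_left bc_right gamma1 delta1 \<open>0 < l\<close> \<open>0 < c1\<close> \<open>0 < \<beta>0\<close>
          in \<open>auto intro: continuous_on_rect_slices(1)[OF ux_cont] continuous_on_rect_slices(1)[OF D_cont]
            continuous_on_rect_slices(1)[OF k_cont] continuous_on_rect_slices(1)[OF q_cont]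
            continuous_on_rect_slices(1)[OF f_cont]\<close>)
    then show "integral {0..l} (\<lambda>x. H x s) \<le> ?d * N s - \<gamma>1 * E s"
      by (simp add: H_eq G_def)
  qed
  also have "\<dots> = ?d * integral {0..t} N - \<gamma>1 * integral {0..t} E"
    by (subst Henstock_Kurzweil_Integration.integral_diff)
      (use \<gamma>1_pos in \<open>auto intro!: integrable_continuous_real continuous_intros N_cont E_cont\<close>)
  finally have main: "(LINT x:{0..l}|lebesgue. ?P x) - (LINT x:{0..l}|lebesgue. (u0 x)\<^sup>2 * ?W x)
      \<le> ?d * integral {0..t} N - \<gamma>1 * integral {0..t} E" .
  have "(LINT s:{0..t}|lebesgue. norm0_sq l (Dx l u) s + (u 0 s)\<^sup>2 + (u l s)\<^sup>2) = (LINT s:{0..t}|lebesgue. E s)"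
    by (rule set_lebesgue_integral_cong) (use t in \<open>auto simp: E_def norm_ux\<close>)
  moreover have "(LINT s:{0..t}|lebesgue. norm0_sq l f s + (\<mu>1 s)\<^sup>2 + (\<mu>2 s)\<^sup>2) = (LINT s:{0..t}|lebesgue. N s)"
    by (rule set_lebesgue_integral_cong) (use t in \<open>auto simp: N_def norm_f\<close>)
  ultimately show "(LINT x:{0..l}|lebesgue. ?P x)
      + \<gamma>1 * (LINT s:{0..t}|lebesgue. norm0_sq l (Dx l u) s + (u 0 s)\<^sup>2 + (u l s)\<^sup>2)
      \<le> ?d * (LINT s:{0..t}|lebesgue. norm0_sq l f s + (\<mu>1 s)\<^sup>2 + (\<mu>2 s)\<^sup>2)
        + (LINT x:{0..l}|lebesgue. (u0 x)\<^sup>2 * ?W x)"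
    using main by (simp only: set_lebesgue_integral_continuous[OF N_cont] set_lebesgue_integral_continuous[OF E_cont])
qed

end
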